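(* Let $w\in\mathbb{C}$, let $z\in\mathbb{C}$ with $\mathrm{Re}(z)>0$, and let $x\in\mathbb{C}$ with $|\arg(x)|<\frac{\pi}{4}$ (equivalently $\mathrm{Re}(x^2)>0$ and $\mathrm{Re}(x)>0$). Then $$2\sum_{n=1}^\infty\left(\frac{nx}{2}\right)^zK_{z,w}(nx)+\frac{1}{2}\Gamma(z)\,{}_1F_1\left(z;\frac{1}{2};-\frac{w^2}{4}\right)-\frac{\sqrt{\pi}}{x}\Gamma\left(\frac{1}{2}+z\right)e^{-\frac{w^2}{4}}{}_1F_1\left(\frac{1}{2}+z;\frac{1}{2};-\frac{w^2}{4}\right)$$ $$=\sqrt{\pi}\,x^{2z}\,\Gamma\left(\frac{1}{2}+z\right)e^{-\frac{w^2}{4}}\sum_{n=1}^\infty\frac{\mathcal{A}(n,z,w,x)}{(x^2+4n^2\pi^2)^{z+\frac{1}{2}}}.$$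
   Context: All complex powers are principal values. The confluent hypergeometric function is ${}_1F_1(a;c;\xi)=\sum_{n=0}^\infty\frac{(a)_n}{(c)_n}\frac{\xi^n}{n!}$, where $(a)_n=\Gamma(a+n)/\Gamma(a)=a(a+1)\cdots(a+n-1)$. The generalized modified Bessel function is defined, for $z,w\in\mathbb{C}$ and $|\arg x|<\frac{\pi}{4}$ (the range needed here), by $$K_{z,w}(x)=\frac{1}{2\pi i}\int_{c-i\infty}^{c+i\infty}\Gamma\left(\frac{s-z}{2}\right)\Gamma\left(\frac{s+z}{2}\right){}_1F_1\left(\frac{s-z}{2};\frac{1}{2};-\frac{w^2}{4}\right){}_1F_1\left(\frac{s+z}{2};\frac{1}{2};-\frac{w^2}{4}\right)2^{s-2}x^{-s}\,ds,$$ where $c=\mathrm{Re}(s)>|\mathrm{Re}(z)|$. The function $\mathcal{A}$ is $$\mathcal{A}(n,z,w,x)={}_1F_1\left(\frac{1}{2}+z;\frac{1}{2};\frac{w^2(2n\pi+ix)}{8n\pi-4ix}\right)+{}_1F_1\left(\frac{1}{2}+z;\frac{1}{2};\frac{w^2(2n\pi-ix)}{8n\pi+4ix}\right).$$ *)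

theory Defs
  imports "HOL-Analysis.Analysis"
begin

definition hyp1F1 :: "complex \<Rightarrow> complex \<Rightarrow> complex \<Rightarrow> complex" where
  "hyp1F1 a c \<xi> = (\<Sum>n. pochhammer a n / pochhammer c n * (\<xi> ^ n / fact n))"

definition bessel_integrand :: "complex \<Rightarrow> complex \<Rightarrow> complex \<Rightarrow> complex \<Rightarrow> complex" where
  "bessel_integrand z w x s =
     Gamma ((s - z) / 2) * Gamma ((s + z) / 2)
     * hyp1F1 ((s - z) / 2) (1 / 2) (- (w\<^sup>2 / 4))
     * hyp1F1 ((s + z) / 2) (1 / 2) (- (w\<^sup>2 / 4))
     * 2 powr (s - 2) * x powr (- s)"

text \<open>
  The line \<open>Re s = c\<close> is parametrised by \<open>s = c + \<i> t\<close>, which gives the factor \<open>\<i>\<close> from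
  \<open>ds = \<i> dt\<close>. The value of the integral does not depend on \<open>c\<close> as long as \<open>c > |Re z|\<close>, so
  \<open>gen_bessel_K z w x\<close> is the common value for all such \<open>c\<close>. For \<open>x \<noteq> 0\<close> with
  \<open>|Arg x| < \<pi>/4\<close> these integrals converge absolutely, since the decay
  \<open>exp (- \<pi> |t| / 2)\<close> of the Gamma factors, up to powers of \<open>|t|\<close>, beats the growth
  \<open>exp (O (sqrt |t|))\<close> of the hypergeometric factors and \<open>exp (|Arg x| |t|)\<close> of \<open>x powr (- s)\<close>.
\<close>

definition gen_bessel_K :: "complex \<Rightarrow> complex \<Rightarrow> complex \<Rightarrow> complex" where
  "gen_bessel_K z w x =
     (THE K. \<forall>c > \<bar>Re z\<bar>.
        has_bochner_integral lborel
          (\<lambda>t. 1 / (2 * of_real pi * \<i>) * (bessel_integrand z w x (Complex c t) * \<i>)) K)"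

definition calA :: "nat \<Rightarrow> complex \<Rightarrow> complex \<Rightarrow> complex \<Rightarrow> complex" where
  "calA n z w x =
     hyp1F1 (1 / 2 + z) (1 / 2)
       (w\<^sup>2 * (2 * of_nat n * of_real pi + \<i> * x) / (8 * of_nat n * of_real pi - 4 * \<i> * x))
     + hyp1F1 (1 / 2 + z) (1 / 2)
       (w\<^sup>2 * (2 * of_nat n * of_real pi - \<i> * x) / (8 * of_nat n * of_real pi + 4 * \<i> * x))"

end

theory Submission
  imports Defs
    "HOL-Complex_Analysis.Complex_Analysis"
    "HOL-Probability.Characteristic_Functions"
    "HOL-Real_Asymp.Real_Asymp"
begin

text \<open>
  Expanding the cosine gives \<open>\<Gamma>(a) 1F1(a; 1/2; - w\<^sup>2/4) = \<integral> t\<^bsup>a-1\<^esup> h(t) dt\<close> over the positive half-line, where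
  \<open>h(t) = e\<^bsup>-t\<^esup> cos (w \<surd>t)\<close>. Mellin inversion of one of the two factors in the contour integral
  then yields \<open>K(x) = 1/2 (x/2)\<^bsup>-z\<^esup> \<integral> u\<^bsup>z-1\<^esup> h(u) h(x\<^sup>2/4u) du\<close>. Summing this over the multiples
  \<open>n x\<close> under the integral produces a theta series \<open>1 + 2 \<Sum> e\<^bsup>-n\<^sup>2 A\<^esup> cos (n B)\<close> with
  \<open>A = x\<^sup>2/4u\<close> and \<open>B = w x/(2 \<surd>u)\<close>. Its modular transformation turns the sum into the
  constant terms and, after integrating \<open>cos \<sqdot> cosh\<close> termwise, the series of confluent
  hypergeometric functions on the right.
\<close>

section \<open>Mellin transforms on the half-line\<close>

text \<open>The condition on \<open>Arg x\<close> says that x^2 lies in the open right half-plane.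
  Hence A does too for every u > 0, so the theta series converges. It also keeps the arguments of
  x^2 and x^2 + 4 n^2 pi^2 small enough for principal powers to be divided without correction. All
  parameters are complex, so the Gamma integrals, the Fourier expansion and the theta identity are
  needed off the real axis. For the last one the periodised Gaussian is entire, and complex shifts
  of the contour relate its Fourier coefficients to each other. Sum and integral are interchanged on
  both sides of the theta identity. The Gaussian factor helps only where its argument, n/sqrt t on
  one side and n sqrt t on the other, is large. It is therefore traded for a negative power of that
  argument, which separates n from t. On the transformed side, summability over n asks for a large
  power and integrability at t = 0 for a small one; Re z > 0 leaves room for both.\<close>

abbreviation halfline :: "real measure" where
  "halfline \<equiv> restrict_space lborel {0<..}"

section \<open>Transfer and substitution rules for Bochner integrals\<close>

lemma has_bochner_integral_eqI:
  assumes "has_bochner_integral M f a" "\<And>x. x \<in> space M \<Longrightarrow> g x = f x" "b = a"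
  shows "has_bochner_integral M g b"
  using assms has_bochner_integral_cong[of M M g f b a] by simp

lemma integrable_eqI:
  assumes "integrable M f" "\<And>x. x \<in> space M \<Longrightarrow> g x = f x"
  shows "integrable M g"
  using assms Bochner_Integration.integrable_cong[of M M g f] by simp

lemma sigma_finite_halfline: "sigma_finite_measure halfline"
  by (rule sigma_finite_measure_restrict_space) (auto intro: sigma_finite_lborel)

lemma measurable_halfline [measurable (raw)]:
  "f \<in> borel_measurable borel \<Longrightarrow> f \<in> borel_measurable halfline"
  by (rule measurable_restrict_space1) simp

text \<open>A bridge from Bochner integrals over a restricted measure to gauge integrals, in terms
  of which the substitution theorem and the basic Gamma integral are stated. Borel measurability of
  \<open>f\<close> lets \<open>lborel\<close> and its completion be exchanged.\<close>

lemma
  fixes f :: "real \<Rightarrow> 'a::euclidean_space"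
  assumes f: "f \<in> borel_measurable borel" and S: "S \<in> sets borel"
  shows integrable_restrict_lborel_iff: "integrable (restrict_space lborel S) f \<longleftrightarrow> f absolutely_integrable_on S"
    and integral_restrict_lborel_eq: "integrable (restrict_space lborel S) f \<Longrightarrow>
      integral\<^sup>L (restrict_space lborel S) f = integral S f"
proof -
  have "set_integrable lborel S f \<longleftrightarrow> set_integrable lebesgue S f"
    unfolding set_integrable_def using f S by (subst integrable_completion) auto
  then show iff: "integrable (restrict_space lborel S) f \<longleftrightarrow> f absolutely_integrable_on S"
    using S by (simp add: integrable_restrict_space set_integrable_def)
  assume "integrable (restrict_space lborel S) f"
  then have "set_integrable lborel S f"
    using S by (simp add: integrable_restrict_space set_integrable_def)
  from set_borel_integral_eq_integral(2)[OF this]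
  show "integral\<^sup>L (restrict_space lborel S) f = integral S f"
    using S by (simp add: integral_restrict_space set_lebesgue_integral_def)
qed

text \<open>Three substitutions rely on this: the scaling t -> r t, the exponential that turns
  Mellin into Fourier integrals, and v -> v^2 for the Gaussian. All three map injectively onto the
  half-line.\<close>

lemma
  fixes f :: "real \<Rightarrow> 'a::euclidean_space" and g h :: "real \<Rightarrow> real"
  assumes f [measurable]: "f \<in> borel_measurable borel" and g [measurable]: "g \<in> borel_measurable borel"
    and h [measurable]: "h \<in> borel_measurable borel"
    and S: "S \<in> sets borel" and T: "T \<in> sets borel" and gS: "g ` S = T" and inj: "inj_on g S"
    and der: "\<And>x. x \<in> S \<Longrightarrow> (g has_field_derivative h x) (at x)"
  shows integrable_change_of_variables:
      "integrable (restrict_space lborel T) f \<longleftrightarrow>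
       integrable (restrict_space lborel S) (\<lambda>x. \<bar>h x\<bar> *\<^sub>R f (g x))"
    and integral_change_of_variables:
      "integrable (restrict_space lborel T) f \<Longrightarrow>
       integral\<^sup>L (restrict_space lborel T) f = integral\<^sup>L (restrict_space lborel S) (\<lambda>x. \<bar>h x\<bar> *\<^sub>R f (g x))"
proof -
  have der': "(g has_field_derivative h x) (at x within S)" if "x \<in> S" for x
    using der[OF that] by (rule has_field_derivative_at_within)
  have Sl: "S \<in> sets lebesgue" using S by (simp add: sets_completionI_sets)
  have fg: "(\<lambda>x. \<bar>h x\<bar> *\<^sub>R f (g x)) \<in> borel_measurable borel" by measurable
  show iff: "integrable (restrict_space lborel T) f \<longleftrightarrow>
       integrable (restrict_space lborel S) (\<lambda>x. \<bar>h x\<bar> *\<^sub>R f (g x))"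
    using absolutely_integrable_change_of_variables_real[OF Sl der' inj, of f] gS
    by (simp add: integrable_restrict_lborel_iff[OF f T] integrable_restrict_lborel_iff[OF fg S])
  assume int: "integrable (restrict_space lborel T) f"
  have "integral S (\<lambda>x. \<bar>h x\<bar> *\<^sub>R f (g x)) = integral (g ` S) f"
    using has_absolute_integral_change_of_variables_real[OF Sl der' inj, of f "integral (g ` S) f"]
      int[unfolded integrable_restrict_lborel_iff[OF f T]] gS by auto
  then show "integral\<^sup>L (restrict_space lborel T) f = integral\<^sup>L (restrict_space lborel S) (\<lambda>x. \<bar>h x\<bar> *\<^sub>R f (g x))"
    using int iff gS by (simp add: integral_restrict_lborel_eq[OF f T] integral_restrict_lborel_eq[OF fg S])
qed

section \<open>Gamma integrals with a complex rate, without and with a cosine\<close>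

lemma Gamma_integral_halfline:
  assumes a: "Re a > 0"
  shows "has_bochner_integral halfline (\<lambda>t. of_real t powr (a - 1) * exp (- of_real t)) (Gamma a)"
proof -
  let ?f = "\<lambda>t::real. complex_of_real t powr (a - 1) * exp (- of_real t)"
  have eq: "?f = (\<lambda>t. of_real t powr (a - 1) / of_real (exp t))"
    by (auto simp: exp_minus exp_of_real field_simps)
  have m: "?f \<in> borel_measurable borel" by measurable
  have "?f absolutely_integrable_on {0<..}"
    unfolding eq by (rule absolutely_integrable_Gamma_integral'[OF a])
  moreover have "integral {0<..} ?f = Gamma a"
    unfolding eq by (rule integral_unique[OF Gamma_integral_complex'[OF a]])
  ultimately show ?thesis
    using integrable_restrict_lborel_iff[OF m, of "{0<..}"] integral_restrict_lborel_eq[OF m, of "{0<..}"]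
    by (simp add: has_bochner_integral_iff)
qed

lemma Gamma_integral_halfline_scale:
  assumes a: "Re a > 0" and r: "r > 0"
  shows "has_bochner_integral halfline (\<lambda>t. of_real t powr (a - 1) * exp (- of_real (r * t)))
           (Gamma a * of_real r powr (- a))"
proof -
  let ?f = "\<lambda>t::real. complex_of_real t powr (a - 1) * exp (- of_real t)"
  let ?g = "\<lambda>t::real. complex_of_real t powr (a - 1) * exp (- of_real (r * t))"
  have img: "(*) r ` {0<..} = {0<..}"
    using r by (auto simp: image_iff intro!: bexI[of _ "x / r" for x])
  note cov = integrable_change_of_variables[of ?f "\<lambda>t. r * t" "\<lambda>_. r" "{0<..}" "{0<..}"]
    integral_change_of_variables[of ?f "\<lambda>t. r * t" "\<lambda>_. r" "{0<..}" "{0<..}"]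
  have int: "integrable halfline (\<lambda>t. \<bar>r\<bar> *\<^sub>R ?f (r * t))"
    and val: "integral\<^sup>L halfline (\<lambda>t. \<bar>r\<bar> *\<^sub>R ?f (r * t)) = Gamma a"
    using Gamma_integral_halfline[OF a] r cov img
    by (auto simp: has_bochner_integral_iff inj_on_def intro!: derivative_eq_intros)
  have eq: "\<bar>r\<bar> *\<^sub>R ?f (r * t) = of_real r powr a * ?g t" if "t \<in> space halfline" for t
    using r that by (auto simp: space_restrict_space scaleR_conv_of_real powr_times_real
      powr_diff field_simps)
  have "has_bochner_integral halfline (\<lambda>t. of_real r powr a * ?g t) (Gamma a)"
    by (intro has_bochner_integral_eqI[OF _ eq[symmetric]])
       (use int val in \<open>auto simp: has_bochner_integral_iff\<close>)
  then have "has_bochner_integral halfline (\<lambda>t. of_real r powr (-a) * (of_real r powr a * ?g t)) (of_real r powr (-a) * Gamma a)"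
    by (intro has_bochner_integral_mult_right)
  moreover have "of_real r powr (-a) * of_real r powr a = 1"
    using r by (simp add: powr_minus)
  ultimately have "has_bochner_integral halfline ?g (of_real r powr (-a) * Gamma a)"
    by (simp add: mult.assoc[symmetric])
  then show ?thesis by (simp add: mult.commute[of "Gamma a"])
qed

text \<open>Dominated convergence for the partial sums. The expansions below are of exponential
  type, so a majorant of all partial sums is at hand, and the integrals of the norms of single terms
  never have to be computed.\<close>

lemma
  fixes f :: "nat \<Rightarrow> 'a \<Rightarrow> 'b::{banach, second_countable_topology}"
  assumes f: "\<And>n. integrable M (f n)" and G: "integrable M G"
    and sums: "\<And>x. x \<in> space M \<Longrightarrow> (\<lambda>n. f n x) sums F x"
    and bound: "\<And>N x. x \<in> space M \<Longrightarrow> norm (\<Sum>n<N. f n x) \<le> G x"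
  shows integrable_sums_dominated: "integrable M F"
    and integral_sums_dominated: "(\<lambda>n. integral\<^sup>L M (f n)) sums integral\<^sup>L M F"
proof -
  have F: "F \<in> borel_measurable M"
    by (rule borel_measurable_LIMSEQ_metric[where f = "\<lambda>N x. \<Sum>n<N. f n x"])
       (use f sums in \<open>auto simp: sums_def intro!: borel_measurable_sum borel_measurable_integrable\<close>)
  have m: "(\<lambda>x. \<Sum>n<N. f n x) \<in> borel_measurable M" for N
    using f by (auto intro!: borel_measurable_sum borel_measurable_integrable)
  have lim: "AE x in M. (\<lambda>N. \<Sum>n<N. f n x) \<longlonglongrightarrow> F x"
    using sums by (auto simp: sums_def)
  have bd: "AE x in M. norm (\<Sum>n<N. f n x) \<le> G x" for N
    using bound by auto
  show "integrable M F"
    by (rule integrable_dominated_convergence[OF F m G lim bd])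
  have "(\<lambda>N. integral\<^sup>L M (\<lambda>x. \<Sum>n<N. f n x)) \<longlonglongrightarrow> integral\<^sup>L M F"
    by (rule integral_dominated_convergence[OF F m G lim bd])
  then show "(\<lambda>n. integral\<^sup>L M (f n)) sums integral\<^sup>L M F"
    using f by (simp add: sums_def)
qed

lemma Gamma_plus_nat:
  assumes "Re a > 0"
  shows "Gamma (a + of_nat n) = Gamma a * pochhammer a n"
proof -
  have "a \<notin> \<int>\<^sub>\<le>\<^sub>0" using assms by (auto elim!: nonpos_Ints_cases)
  then show ?thesis by (simp add: pochhammer_Gamma Gamma_eq_zero_iff)
qed

lemma integrable_powr_exp_halfline:
  assumes "Re a > 0" "r > 0"
  shows "integrable halfline (\<lambda>t. t powr (Re a - 1) * exp (- r * t))"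
proof -
  have "integrable halfline (\<lambda>t. norm (of_real t powr (a - 1) * exp (- of_real (r * t) :: complex)))"
    using Gamma_integral_halfline_scale[OF assms] by (intro integrable_norm) (auto simp: has_bochner_integral_iff)
  moreover have "norm (of_real t powr (a - 1) * exp (- of_real (r * t) :: complex)) = t powr (Re a - 1) * exp (- r * t)"
    if "t \<in> space halfline" for t
    using that by (simp add: norm_mult norm_powr_real_powr space_restrict_space)
  ultimately show ?thesis
    by (rule integrable_eqI[OF _ sym])
qed

lemma norm_exp_partial_sum_le: "norm (\<Sum>n<N. z ^ n / fact n) \<le> exp (norm z)" for z :: complex
proof -
  have s: "(\<lambda>n. norm z ^ n / fact n) sums exp (norm z)"
    using exp_converges[of "norm z"] by (simp add: field_simps)
  have "norm (\<Sum>n<N. z ^ n / fact n) \<le> (\<Sum>n<N. norm z ^ n / fact n)"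
    by (rule order_trans[OF norm_sum]) (simp add: norm_divide norm_power)
  also have "\<dots> \<le> exp (norm z)"
    using sum_le_suminf[OF sums_summable[OF s], of "{..<N}"] sums_unique[OF s] by simp
  finally show ?thesis .
qed

text \<open>The open right half-plane is the union of the discs with centre r > 0 whose boundary
  passes through 0.\<close>

lemma exists_ball_real_centre:
  assumes "Re p > 0"
  obtains r where "r > 0" "norm (of_real r - p) < r"
proof -
  \<comment> \<open>Squaring shows that the inequality holds as soon as r exceeds |p|^2 / (2 Re p);
    twice this threshold is taken.\<close>
  define r where "r = (norm p)\<^sup>2 / Re p"
  have p0: "p \<noteq> 0" using assms by auto
  have r: "r > 0" using assms p0 by (simp add: r_def)
  have "(norm (of_real r - p))\<^sup>2 = r\<^sup>2 - 2 * r * Re p + (norm p)\<^sup>2"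
    unfolding cmod_power2 by (simp add: power2_eq_square algebra_simps)
  also have "\<dots> = r\<^sup>2 - (norm p)\<^sup>2"
    using assms by (simp add: r_def)
  also have "\<dots> < r\<^sup>2" using p0 by simp
  finally have "norm (of_real r - p) < r"
    using r by (simp add: power2_less_imp_less)
  with r that show thesis by blast
qed

lemma powr_of_real_mult:
  assumes "r > 0"
  shows "(of_real r * z) powr a = of_real r powr a * z powr (a::complex)"
  using assms by (cases "z = 0") (simp_all add: powr_def Ln_times_of_real Ln_of_real ring_distribs exp_add)

text \<open>Expanding \<open>exp (- p t)\<close> around a large real exponent \<open>r\<close> with \<open>\<bar>r - p\<bar> < r\<close> reduces the
  integral to the binomial series of \<open>p powr (- a)\<close>.\<close>

lemma Gamma_integral_halfline_complex:
  assumes a: "Re a > 0" and p: "Re p > 0"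
  shows "has_bochner_integral halfline (\<lambda>t. of_real t powr (a - 1) * exp (- p * of_real t))
           (Gamma a * p powr (- a))"
proof -
  obtain r where r: "r > 0" "norm (of_real r - p) < r"
    using exists_ball_real_centre[OF p] .
  let ?F = "\<lambda>t::real. of_real t powr (a - 1) * exp (- p * of_real t)"
  \<comment> \<open>The rate r - |r - p| is positive by the choice of r. It is what remains of
    exp(-r t) after the partial sums of exp((r - p) t) have been bounded by exp(|r - p| t).\<close>
  let ?G = "\<lambda>t. t powr (Re a - 1) * exp (- (r - norm (of_real r - p)) * t)"
  define f where "f = (\<lambda>n (t::real). of_real t powr (a - 1) * exp (- of_real (r * t))
     * (((of_real r - p) * of_real t) ^ n / fact n))"
  define u where "u = (p - of_real r) / of_real r"
  have u: "norm u < 1" using r by (simp add: u_def norm_divide norm_minus_commute)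
  have pu: "p = of_real r * (1 + u)" using r by (simp add: u_def field_simps)
  have f_eq: "f n t = (of_real r - p) ^ n / fact n * (of_real t powr (a + of_nat n - 1) * exp (- of_real (r * t)))"
    if "t \<in> space halfline" for n t
  proof -
    have "t > 0" using that by (simp add: space_restrict_space)
    then have "of_real t powr (a + of_nat n - 1) = of_real t powr (a - 1) * of_real t ^ n"
      using powr_add[of "of_real t" "a - 1" "of_nat n"] by (simp add: powr_nat' algebra_simps)
    then show ?thesis by (simp add: f_def power_mult_distrib)
  qed
  have hbi: "has_bochner_integral halfline (f n)
      (Gamma a * of_real r powr (- a) * ((- a) gchoose n) * u ^ n)" for n
  proof -
    have "has_bochner_integral halfline (\<lambda>t. (of_real r - p) ^ n / fact n * (of_real t powr (a + of_nat n - 1) * exp (- of_real (r * t))))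
        ((of_real r - p) ^ n / fact n * (Gamma (a + of_nat n) * of_real r powr (- (a + of_nat n))))"
      by (rule has_bochner_integral_mult_right, rule Gamma_integral_halfline_scale) (use a r in auto)
    moreover have "(of_real r - p) ^ n / fact n * (Gamma (a + of_nat n) * of_real r powr (- (a + of_nat n)))
       = Gamma a * of_real r powr (- a) * ((- a) gchoose n) * u ^ n"
    proof -
      have "of_real r powr (- (a + of_nat n)) = of_real r powr (- a) / of_real r ^ n"
        using r by (simp add: powr_diff powr_nat' flip: diff_conv_add_uminus)
      moreover have "(of_real r - p) ^ n = (- 1) ^ n * u ^ n * of_real r ^ n"
        using r by (simp add: u_def flip: power_mult_distrib)
      ultimately show ?thesis using r
        by (simp add: Gamma_plus_nat[OF a] gbinomial_pochhammer)
    qed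
    ultimately show ?thesis
      by (intro has_bochner_integral_eqI[OF _ f_eq]) auto
  qed
  have int_f: "integrable halfline (f n)" for n
    using hbi by (auto simp: has_bochner_integral_iff)
  have G: "integrable halfline ?G"
    by (rule integrable_powr_exp_halfline) (use a r in auto)
  have sums: "(\<lambda>n. f n t) sums ?F t" for t
  proof -
    have "(\<lambda>n. of_real t powr (a - 1) * exp (- of_real (r * t)) * (((of_real r - p) * of_real t) ^ n / fact n))
      sums (of_real t powr (a - 1) * exp (- of_real (r * t)) * exp ((of_real r - p) * of_real t))"
      by (intro sums_mult) (use exp_converges[of "(of_real r - p) * of_real t"] in \<open>simp add: scaleR_conv_of_real field_simps\<close>)
    also have "of_real t powr (a - 1) * exp (- of_real (r * t)) * exp ((of_real r - p) * of_real t) = ?F t"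
      by (simp add: mult.assoc flip: exp_add) (simp add: algebra_simps)
    finally show ?thesis unfolding f_def .
  qed
  have bound: "norm (\<Sum>n<N. f n t) \<le> ?G t" if "t \<in> space halfline" for N t
  proof -
    have t: "t > 0" using that by (simp add: space_restrict_space)
    have "norm (\<Sum>n<N. f n t) = t powr (Re a - 1) * exp (- r * t) * norm (\<Sum>n<N. ((of_real r - p) * of_real t) ^ n / fact n)"
      unfolding f_def sum_distrib_left[symmetric] using t
      by (simp add: norm_mult norm_powr_real_powr)
    also have "\<dots> \<le> t powr (Re a - 1) * exp (- r * t) * exp (norm ((of_real r - p) * of_real t))"
      by (intro mult_left_mono norm_exp_partial_sum_le) auto
    also have "\<dots> = ?G t"
      using t by (simp add: norm_mult mult.assoc flip: exp_add) (simp add: algebra_simps)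
    finally show ?thesis .
  qed
  have "(\<lambda>n. Gamma a * of_real r powr (- a) * (((- a) gchoose n) * u ^ n)) sums
        (Gamma a * of_real r powr (- a) * (1 + u) powr (- a))"
    by (intro sums_mult gen_binomial_complex u)
  moreover have "Gamma a * of_real r powr (- a) * (1 + u) powr (- a) = Gamma a * p powr (- a)"
    unfolding pu using r by (simp add: powr_of_real_mult mult.assoc)
  moreover have "(\<lambda>n. integral\<^sup>L halfline (f n)) sums integral\<^sup>L halfline ?F"
    by (rule integral_sums_dominated[OF int_f G sums bound])
  moreover have "integral\<^sup>L halfline (f n) = Gamma a * of_real r powr (- a) * (((- a) gchoose n) * u ^ n)" for n
    using hbi by (simp add: has_bochner_integral_iff mult.assoc)
  ultimately have "integral\<^sup>L halfline ?F = Gamma a * p powr (- a)"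
    by (auto dest: sums_unique2)
  moreover have "integrable halfline ?F"
    by (rule integrable_sums_dominated[OF int_f G sums bound])
  ultimately show ?thesis by (simp add: has_bochner_integral_iff)
qed

text \<open>The identity (2n)! = 4^n n! (1/2)_n converts the coefficients of the cosine into those
  of a confluent series with lower parameter 1/2. A general rate \<open>p\<close> and frequency
  \<open>q\<close> are allowed since the same integral later yields the terms of the transformed
  series.\<close>

lemma Gamma_cos_integral_halfline:
  assumes a: "Re a > 0" and p: "Re p > 0"
  shows "has_bochner_integral halfline
     (\<lambda>t. of_real t powr (a - 1) * exp (- p * of_real t) * cos (q * of_real (sqrt t)))
     (Gamma a * p powr (- a) * hyp1F1 a (1 / 2) (- (q\<^sup>2 / (4 * p))))"
proof -
  let ?F = "\<lambda>t::real. of_real t powr (a - 1) * exp (- p * of_real t) * cos (q * of_real (sqrt t))"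
  \<comment> \<open>Half of the decay rate Re p is given up to absorb exp(|q| sqrt t), at the price
    of the constant factor.\<close>
  let ?G = "\<lambda>t. exp ((norm q)\<^sup>2 / (2 * Re p)) * (t powr (Re a - 1) * exp (- (Re p / 2) * t))"
  define c where "c = (\<lambda>n. (- 1) ^ n * q ^ (2 * n) / fact (2 * n))"
  define f where "f = (\<lambda>n (t::real). of_real t powr (a - 1) * exp (- p * of_real t) * (c n * of_real t ^ n))"
  have f_eq: "f n t = c n * (of_real t powr (a + of_nat n - 1) * exp (- p * of_real t))"
    if "t \<in> space halfline" for n t
  proof -
    have "t > 0" using that by (simp add: space_restrict_space)
    then have "of_real t powr (a + of_nat n - 1) = of_real t powr (a - 1) * of_real t ^ n"
      using powr_add[of "of_real t" "a - 1" "of_nat n"] by (simp add: powr_nat' algebra_simps)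
    then show ?thesis by (simp add: f_def)
  qed
  have hbi: "has_bochner_integral halfline (f n) (Gamma a * p powr (- a) *
      (pochhammer a n / pochhammer (1 / 2) n * ((- (q\<^sup>2 / (4 * p))) ^ n / fact n)))" for n
  proof -
    have "has_bochner_integral halfline (\<lambda>t. c n * (of_real t powr (a + of_nat n - 1) * exp (- p * of_real t)))
        (c n * (Gamma (a + of_nat n) * p powr (- (a + of_nat n))))"
      by (rule has_bochner_integral_mult_right, rule Gamma_integral_halfline_complex) (use a p in auto)
    moreover have "c n * (Gamma (a + of_nat n) * p powr (- (a + of_nat n))) = Gamma a * p powr (- a) *
      (pochhammer a n / pochhammer (1 / 2) n * ((- (q\<^sup>2 / (4 * p))) ^ n / fact n))"
    proof -
      have "p \<noteq> 0" using p by auto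
      then have "p powr (- (a + of_nat n)) = p powr (- a) / p ^ n"
        by (simp add: powr_diff powr_nat' flip: diff_conv_add_uminus)
      moreover have "(- (q\<^sup>2 / (4 * p))) ^ n = (- 1) ^ n * q ^ (2 * n) / (2 ^ (2 * n) * p ^ n)"
        by (simp add: power_minus[of "q\<^sup>2 / (4 * p)"] power_divide power_mult_distrib power_mult)
      ultimately show ?thesis
        unfolding c_def fact_double Gamma_plus_nat[OF a] by (simp add: mult_ac)
    qed
    ultimately show ?thesis
      by (intro has_bochner_integral_eqI[OF _ f_eq]) auto
  qed
  have int_f: "integrable halfline (f n)" for n
    using hbi by (auto simp: has_bochner_integral_iff)
  have G: "integrable halfline ?G"
    by (intro integrable_mult_right integrable_powr_exp_halfline) (use a p in auto)
  \<comment> \<open>The power series of the cosine has vanishing odd coefficients; grouping its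
    terms in pairs leaves exactly one even term in each block.\<close>
  have c_eq: "c n * of_real t ^ n = (\<Sum>m\<in>{n*2..<n*2+2}. cos_coeff m *\<^sub>R (q * of_real (sqrt t)) ^ m)"
    if "t \<in> space halfline" for n t
  proof -
    have t: "t > 0" using that by (simp add: space_restrict_space)
    have "{n*2..<n*2+2} = {2*n, Suc (2*n)}" by auto
    moreover have "complex_of_real (sqrt t) ^ (2 * n) = of_real t ^ n"
      using t by (simp add: power_mult flip: of_real_power)
    ultimately show ?thesis
      by (simp add: cos_coeff_def c_def power_mult_distrib scaleR_conv_of_real)
  qed
  have sums: "(\<lambda>n. f n t) sums ?F t" if "t \<in> space halfline" for t
    unfolding f_def
    by (intro sums_mult) (use sums_group[OF cos_converges, of 2] c_eq[OF that] in auto)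
  have bound: "norm (\<Sum>n<N. f n t) \<le> ?G t" if ts: "t \<in> space halfline" for N t
  proof -
    have t: "t > 0" using ts by (simp add: space_restrict_space)
    have s: "(\<lambda>n. norm (q * of_real (sqrt t)) ^ n / fact n) sums exp (norm (q * of_real (sqrt t)))"
      using exp_converges[of "norm (q * of_real (sqrt t))"] by (simp add: field_simps)
    have "norm (\<Sum>n<N. c n * of_real t ^ n) \<le> (\<Sum>n<N. norm (q * of_real (sqrt t)) ^ (2*n) / fact (2*n))"
    proof (rule sum_norm_le)
      fix n
      have "(norm q * sqrt t) ^ (2*n) = norm q ^ (2 * n) * t ^ n"
        using t by (simp add: power_mult_distrib power_mult)
      then show "norm (c n * of_real t ^ n) \<le> norm (q * of_real (sqrt t)) ^ (2*n) / fact (2*n)"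
        using t by (simp add: c_def norm_mult norm_divide norm_power)
    qed
    also have "\<dots> = (\<Sum>m\<in>(*) 2 ` {..<N}. norm (q * of_real (sqrt t)) ^ m / fact m)"
      by (subst sum.reindex) (auto simp: inj_on_def)
    also have "\<dots> \<le> exp (norm (q * of_real (sqrt t)))"
      using sum_le_suminf[OF sums_summable[OF s], of "(*) 2 ` {..<N}"] sums_unique[OF s] by simp
    also have "norm (q * of_real (sqrt t)) = norm q * sqrt t"
      using t by (simp add: norm_mult)
    also have "norm q * sqrt t \<le> (norm q)\<^sup>2 / (2 * Re p) + Re p / 2 * t"
    proof -
      have "0 \<le> (norm q - Re p * sqrt t)\<^sup>2" by simp
      also have "\<dots> = (norm q)\<^sup>2 - 2 * Re p * (norm q * sqrt t) + (Re p)\<^sup>2 * t"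
        using t by (simp add: power2_diff power_mult_distrib)
      finally show ?thesis using p by (simp add: field_simps power2_eq_square)
    qed
    finally have le: "norm (\<Sum>n<N. c n * of_real t ^ n) \<le> exp ((norm q)\<^sup>2 / (2 * Re p) + Re p / 2 * t)"
      by simp
    have "norm (\<Sum>n<N. f n t) = t powr (Re a - 1) * exp (- Re p * t) * norm (\<Sum>n<N. c n * of_real t ^ n)"
      unfolding f_def sum_distrib_left[symmetric] using t by (simp add: norm_mult norm_powr_real_powr)
    also have "\<dots> \<le> t powr (Re a - 1) * exp (- Re p * t) * exp ((norm q)\<^sup>2 / (2 * Re p) + Re p / 2 * t)"
      by (intro mult_left_mono le) auto
    also have "\<dots> = ?G t"
    proof -
      have "exp (- Re p * t) * exp ((norm q)\<^sup>2 / (2 * Re p) + Re p / 2 * t) =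
            exp ((norm q)\<^sup>2 / (2 * Re p)) * exp (- (Re p / 2) * t)"
        unfolding exp_add[symmetric] by (simp add: algebra_simps)
      then show ?thesis by simp
    qed
    finally show ?thesis .
  qed
  have sm: "(\<lambda>n. integral\<^sup>L halfline (f n)) sums integral\<^sup>L halfline ?F"
    by (rule integral_sums_dominated[OF int_f G sums bound])
  have val: "integral\<^sup>L halfline (f n) = Gamma a * p powr (- a) *
      (pochhammer a n / pochhammer (1 / 2) n * ((- (q\<^sup>2 / (4 * p))) ^ n / fact n))" for n
    using hbi by (simp add: has_bochner_integral_iff)
  \<comment> \<open>Termwise integration gives the sum of the multiplied series only. Cancelling
    this non-zero factor shows that the confluent series itself converges, so that the
    \<open>suminf\<close> inside \<open>hyp1F1\<close> is its genuine value.\<close>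
  have nz: "Gamma a * p powr (- a) \<noteq> 0"
  proof -
    have "a \<notin> \<int>\<^sub>\<le>\<^sub>0" using a by (auto elim!: nonpos_Ints_cases)
    moreover have "p \<noteq> 0" using p by auto
    ultimately show ?thesis by (simp add: Gamma_eq_zero_iff)
  qed
  have "summable (\<lambda>n. pochhammer a n / pochhammer (1 / 2) n * ((- (q\<^sup>2 / (4 * p))) ^ n / fact n))"
    using sums_summable[OF sm] unfolding val summable_cmult_iff using nz by blast
  from sums_mult[OF summable_sums[OF this], of "Gamma a * p powr (- a)"]
  have "integral\<^sup>L halfline ?F = Gamma a * p powr (- a) * hyp1F1 a (1 / 2) (- (q\<^sup>2 / (4 * p)))"
    using sm unfolding val hyp1F1_def by (rule sums_unique2[symmetric])
  moreover have "integrable halfline ?F"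
    by (rule integrable_sums_dominated[OF int_f G sums bound])
  ultimately show ?thesis by (simp add: has_bochner_integral_iff)
qed

lemma quadratic_le: "- \<rho> * s\<^sup>2 + \<kappa> * s \<le> \<kappa>\<^sup>2 / (4 * \<rho>)" if "\<rho> > 0" for \<rho> \<kappa> s :: real
proof -
  have "0 \<le> (2 * \<rho> * s - \<kappa>)\<^sup>2" by simp
  then show ?thesis using that by (simp add: field_simps power2_eq_square)
qed

section \<open>Mellin inversion\<close>

text \<open>The characteristic function of the standard normal distribution, cleared of its
  normalising constant.\<close>

lemma iexp_gaussian_integral:
  "has_bochner_integral lborel (\<lambda>x. iexp (t * x) * of_real (exp (- x\<^sup>2 / 2)))
     (of_real (sqrt (2 * pi)) * of_real (exp (- t\<^sup>2 / 2)))"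
proof -
  have "char std_normal_distribution t = (CLINT x|lborel. std_normal_density x *\<^sub>R iexp (t * x))"
    unfolding char_def by (subst integral_density) (auto simp: normal_density_nonneg)
  then have 1: "(CLINT x|lborel. std_normal_density x *\<^sub>R iexp (t * x)) = of_real (exp (- t\<^sup>2 / 2))"
    by (simp add: char_std_normal_distribution)
  have "integrable lborel (\<lambda>x. std_normal_density x *\<^sub>R iexp (t * x))"
    by (rule Bochner_Integration.integrable_bound[of _ std_normal_density]) (auto simp: normal_density_nonneg)
  with 1 have "has_bochner_integral lborel (\<lambda>x. std_normal_density x *\<^sub>R iexp (t * x)) (of_real (exp (- t\<^sup>2 / 2)))"
    by (simp add: has_bochner_integral_iff)
  then have "has_bochner_integral lborel (\<lambda>x. of_real (sqrt (2 * pi)) * (std_normal_density x *\<^sub>R iexp (t * x)))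
     (of_real (sqrt (2 * pi)) * of_real (exp (- t\<^sup>2 / 2)))"
    by (rule has_bochner_integral_mult_right)
  then show ?thesis
    by (rule has_bochner_integral_eqI) (auto simp: std_normal_density_def scaleR_conv_of_real)
qed

lemma integrable_gaussian: "s > 0 \<Longrightarrow> integrable lborel (\<lambda>x. exp (- (x / s)\<^sup>2 / 2) :: real)"
proof -
  assume s: "s > 0"
  have "integrable lborel (\<lambda>x. norm (iexp (0 * x) * complex_of_real (exp (- x\<^sup>2 / 2))))"
    using iexp_gaussian_integral[of 0] by (intro integrable_norm) (auto simp: has_bochner_integral_iff)
  then have "integrable lborel (\<lambda>x. exp (- x\<^sup>2 / 2) :: real)" by simp
  then show ?thesis
    using lborel_integrable_real_affine_iff[of "1 / s" "\<lambda>x. exp (- x\<^sup>2 / 2) :: real" 0] s by simp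
qed

text \<open>Multiplying the transform by a Gaussian of width \<open>s\<close> turns its integral into an average of
  \<open>f\<close> against a Gaussian of width \<open>1 / s\<close>; both sides converge as \<open>s\<close> grows.\<close>

lemma fourier_inversion_at_0:
  fixes f :: "real \<Rightarrow> complex"
  assumes f: "integrable lborel f" and bd: "\<And>v. norm (f v) \<le> B" and cont: "isCont f 0"
    and F: "integrable lborel (\<lambda>\<tau>. CLINT v|lborel. f v * iexp (\<tau> * v))"
  shows "(CLINT \<tau>|lborel. (CLINT v|lborel. f v * iexp (\<tau> * v))) = 2 * of_real pi * f 0"
proof -
  let ?F = "\<lambda>\<tau>. CLINT v|lborel. f v * iexp (\<tau> * v)"
  define g where "g = (\<lambda>x::real. complex_of_real (exp (- x\<^sup>2 / 2)))"
  have gm [measurable]: "g \<in> borel_measurable borel" unfolding g_def by measurable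
  have fm [measurable]: "f \<in> borel_measurable borel"
    using borel_measurable_integrable[OF f] by simp
  have gi: "integrable lborel (\<lambda>x. norm (g (x / s)))" if "s > 0" for s
    using integrable_gaussian[OF that] by (simp add: g_def)
  have gi1: "integrable lborel (\<lambda>x. norm (g x))" using gi[of 1] by simp
  have g1: "norm (g x) \<le> 1" for x by (simp add: g_def)
  \<comment> \<open>The Gaussian weight in \<tau> makes the double integral absolutely convergent;
    without it Fubini would not apply, as the norm of f(v) exp(i \<tau> v) is constant in
    \<tau>.\<close>
  have swap: "(CLINT \<tau>|lborel. ?F \<tau> * g (\<tau> / s)) = of_real (sqrt (2 * pi)) * (CLINT u|lborel. f (u / s) * g u)"
    if s: "s > 0" for s
  proof -
    let ?h = "\<lambda>\<tau> v. f v * iexp (\<tau> * v) * g (\<tau> / s)"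
    have int: "integrable (lborel \<Otimes>\<^sub>M lborel) (\<lambda>(\<tau>, v). ?h \<tau> v)"
    proof (rule lborel_pair.Fubini_integrable)
      show "integrable lborel (\<lambda>\<tau>. LINT v|lborel. norm (case (\<tau>, v) of (\<tau>, v) \<Rightarrow> ?h \<tau> v))"
        using integrable_mult_right[OF gi[OF s], of "LINT v|lborel. norm (f v)"] by (simp add: norm_mult)
      have "integrable lborel (\<lambda>v. f v * iexp (\<tau> * v))" for \<tau>
        by (rule Bochner_Integration.integrable_bound[OF f]) (auto simp: norm_mult)
      then show "AE \<tau> in lborel. integrable lborel (\<lambda>v. case (\<tau>, v) of (\<tau>, v) \<Rightarrow> ?h \<tau> v)"
        by (intro AE_I2) (simp add: integrable_mult_left)
    qed measurable
    have "(CLINT \<tau>|lborel. ?F \<tau> * g (\<tau> / s)) = (CLINT \<tau>|lborel. CLINT v|lborel. ?h \<tau> v)"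
      by simp
    also have "\<dots> = (CLINT v|lborel. CLINT \<tau>|lborel. ?h \<tau> v)"
      using lborel_pair.Fubini_integral[OF int] by simp
    also have "\<dots> = (CLINT v|lborel. f v * (of_real s * (of_real (sqrt (2 * pi)) * g (s * v))))"
    proof (rule Bochner_Integration.integral_cong[OF refl])
      fix v
      have "has_bochner_integral lborel (\<lambda>\<tau>. iexp (\<tau> * v) * g (\<tau> / s)) ((of_real (sqrt (2 * pi)) * g (s * v)) /\<^sub>R \<bar>1 / s\<bar>)"
        using lborel_has_bochner_integral_real_affine_iff[of "1/s" "\<lambda>x. iexp ((s * v) * x) * g x" "of_real (sqrt (2 * pi)) * g (s * v)" 0]
          iexp_gaussian_integral[of "s * v"] s by (simp add: g_def mult_ac)
      then have "(CLINT \<tau>|lborel. iexp (\<tau> * v) * g (\<tau> / s)) = of_real s * (of_real (sqrt (2 * pi)) * g (s * v))"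
        using s by (simp add: has_bochner_integral_iff scaleR_conv_of_real)
      then show "(CLINT \<tau>|lborel. ?h \<tau> v) = f v * (of_real s * (of_real (sqrt (2 * pi)) * g (s * v)))"
        by (simp add: mult.assoc)
    qed
    also have "\<dots> = of_real (sqrt (2 * pi)) * (of_real s * (CLINT v|lborel. f v * g (s * v)))"
      by (simp add: mult_ac flip: integral_mult_right_zero)
    also have "of_real s * (CLINT v|lborel. f v * g (s * v)) = (CLINT u|lborel. f (u / s) * g u)"
      using s lborel_integral_real_affine[of s "\<lambda>u. f (u / s) * g u" 0] by (simp add: scaleR_conv_of_real)
    finally show ?thesis .
  qed
  have "(\<lambda>n. CLINT \<tau>|lborel. ?F \<tau> * g (\<tau> / real (Suc n))) \<longlonglongrightarrow> (CLINT \<tau>|lborel. ?F \<tau>)"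
  proof (rule integral_dominated_convergence[where w = "\<lambda>\<tau>. norm (?F \<tau>)"])
    show "AE \<tau> in lborel. (\<lambda>n. ?F \<tau> * g (\<tau> / real (Suc n))) \<longlonglongrightarrow> ?F \<tau>"
    proof (rule AE_I2)
      fix \<tau> :: real
      have "(\<lambda>n. \<tau> / real (Suc n)) \<longlonglongrightarrow> 0" by (rule LIMSEQ_Suc[OF lim_const_over_n])
      then have "(\<lambda>n. exp (- (\<tau> / real (Suc n))\<^sup>2 / 2)) \<longlonglongrightarrow> exp (- 0\<^sup>2 / 2)"
        by (intro tendsto_intros) auto
      then have "(\<lambda>n. exp (- (\<tau> / real (Suc n))\<^sup>2 / 2)) \<longlonglongrightarrow> 1" by simp
      from tendsto_mult[OF tendsto_const[of "?F \<tau>"] tendsto_of_real[OF this, where 'a = complex]]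
      show "(\<lambda>n. ?F \<tau> * g (\<tau> / real (Suc n))) \<longlonglongrightarrow> ?F \<tau>" by (simp add: g_def)
    qed
    show "integrable lborel (\<lambda>\<tau>. norm (?F \<tau>))" by (rule integrable_norm[OF F])
    show "AE \<tau> in lborel. norm (?F \<tau> * g (\<tau> / real (Suc n))) \<le> norm (?F \<tau>)" for n
      using g1 by (simp add: norm_mult mult_left_le)
  qed (use borel_measurable_integrable[OF F] in measurable)
  moreover have "(\<lambda>n. of_real (sqrt (2 * pi)) * (CLINT u|lborel. f (u / real (Suc n)) * g u)) \<longlonglongrightarrow>
      of_real (sqrt (2 * pi)) * (CLINT u|lborel. f 0 * g u)"
  proof (rule tendsto_mult_left, rule integral_dominated_convergence[where w = "\<lambda>u. B * norm (g u)"])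
    show "AE u in lborel. (\<lambda>n. f (u / real (Suc n)) * g u) \<longlonglongrightarrow> f 0 * g u"
    proof (rule AE_I2, rule tendsto_mult_right)
      fix u :: real
      have "(\<lambda>n. u / real (Suc n)) \<longlonglongrightarrow> 0" by (rule LIMSEQ_Suc[OF lim_const_over_n])
      then show "(\<lambda>n. f (u / real (Suc n))) \<longlonglongrightarrow> f 0"
        by (rule isCont_tendsto_compose[OF cont])
    qed
    show "integrable lborel (\<lambda>u. B * norm (g u))" by (intro integrable_mult_right gi1)
    show "AE u in lborel. norm (f (u / real (Suc n)) * g u) \<le> B * norm (g u)" for n
      using bd by (simp add: norm_mult mult_right_mono)
  qed measurable
  moreover have "(\<lambda>n. CLINT \<tau>|lborel. ?F \<tau> * g (\<tau> / real (Suc n))) =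
      (\<lambda>n. of_real (sqrt (2 * pi)) * (CLINT u|lborel. f (u / real (Suc n)) * g u))"
    by (intro ext swap) simp
  ultimately have "(CLINT \<tau>|lborel. ?F \<tau>) = of_real (sqrt (2 * pi)) * (CLINT u|lborel. f 0 * g u)"
    using LIMSEQ_unique by (metis (no_types, lifting))
  also have "(CLINT u|lborel. f 0 * g u) = f 0 * of_real (sqrt (2 * pi))"
    using iexp_gaussian_integral[of 0] by (simp add: has_bochner_integral_iff g_def)
  also have "of_real (sqrt (2 * pi)) * (f 0 * of_real (sqrt (2 * pi))) = 2 * of_real pi * f 0"
  proof -
    have "complex_of_real (sqrt (2 * pi)) * of_real (sqrt (2 * pi)) = of_real (2 * pi)"
      by (simp only: of_real_mult[symmetric] real_sqrt_mult_self) simp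
    then show ?thesis by (simp add: mult.assoc[symmetric] mult.commute[of _ "f 0"])
  qed
  finally show ?thesis .
qed

section \<open>The damped cosine and its Mellin transform\<close>

definition hyp_gamma :: "complex \<Rightarrow> complex \<Rightarrow> complex" where
  "hyp_gamma w a = Gamma a * hyp1F1 a (1 / 2) (- (w\<^sup>2 / 4))"

text \<open>Since the cosine is even, the choice of the square root is immaterial and the function
  is entire in its second argument. Its Mellin transform is \<open>hyp_gamma w\<close>.\<close>

definition exp_cos :: "complex \<Rightarrow> complex \<Rightarrow> complex" where
  "exp_cos w y = exp (- y) * cos (w * csqrt y)"

lemma csqrt_mult_of_real: "t > 0 \<Longrightarrow> csqrt (y * of_real t) = csqrt y * of_real (sqrt t)"
proof (cases "y = 0")
  case False
  assume t: "t > 0"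
  show ?thesis
    by (rule csqrt_unique) (use t csqrt_principal[of y] in \<open>auto simp: power_mult_distrib simp flip: of_real_power\<close>)
qed simp

text \<open>The frequency w csqrt y satisfies (w csqrt y)^2 / (4 y) = w^2 / 4, so \<open>y\<close>
  leaves the confluent factor and survives only in the power \<open>y powr (- a)\<close>.\<close>

lemma mellin_exp_cos:
  assumes "Re a > 0" "Re y > 0"
  shows "has_bochner_integral halfline (\<lambda>t. of_real t powr (a - 1) * exp_cos w (y * of_real t))
           (hyp_gamma w a * y powr (- a))"
proof -
  have y: "y \<noteq> 0" using assms by auto
  have "has_bochner_integral halfline
     (\<lambda>t. of_real t powr (a - 1) * exp (- y * of_real t) * cos ((w * csqrt y) * of_real (sqrt t)))
     (Gamma a * y powr (- a) * hyp1F1 a (1 / 2) (- ((w * csqrt y)\<^sup>2 / (4 * y))))"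
    by (rule Gamma_cos_integral_halfline[OF assms])
  then show ?thesis
    by (rule has_bochner_integral_eqI)
       (use y in \<open>auto simp: exp_cos_def hyp_gamma_def csqrt_mult_of_real space_restrict_space power_mult_distrib mult_ac\<close>)
qed

lemma measurable_csqrt [measurable]: "csqrt \<in> borel_measurable borel"
  unfolding csqrt_conv_powr[abs_def] by measurable

lemma measurable_exp_cos [measurable]: "exp_cos w \<in> borel_measurable borel"
  unfolding exp_cos_def[abs_def] by measurable

lemma norm_powr_of_real: "t > 0 \<Longrightarrow> norm (complex_of_real t powr a) = t powr Re a"
  by (simp add: norm_powr_real_powr)

lemma measurable_Complex [measurable (raw)]:
  assumes "f \<in> borel_measurable M"
  shows "(\<lambda>x. Complex \<sigma> (f x)) \<in> borel_measurable M"
proof -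
  have "Complex \<sigma> t = of_real \<sigma> + \<i> * of_real t" for t by (simp add: complex_eq_iff)
  then show ?thesis using assms by simp
qed

text \<open>Read off from the integral representation: a parameter integral of a jointly measurable
  function is measurable in the parameter.\<close>

lemma hyp_gamma_measurable_line:
  assumes "\<sigma> > 0"
  shows "(\<lambda>\<tau>. hyp_gamma w (Complex \<sigma> \<tau>)) \<in> borel_measurable borel"
proof -
  have [measurable]: "(\<lambda>p. snd p) \<in> borel_measurable (borel \<Otimes>\<^sub>M halfline)"
    by (rule measurable_compose[OF measurable_snd]) measurable
  interpret sigma_finite_measure halfline by (rule sigma_finite_halfline)
  have "(\<lambda>\<tau>. CLINT t|halfline. of_real t powr (Complex \<sigma> \<tau> - 1) * exp_cos w (1 * of_real t)) \<in> borel_measurable borel"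
    by measurable
  moreover have "(CLINT t|halfline. of_real t powr (Complex \<sigma> \<tau> - 1) * exp_cos w (1 * of_real t)) = hyp_gamma w (Complex \<sigma> \<tau>)" for \<tau>
    using mellin_exp_cos[of "Complex \<sigma> \<tau>" 1 w] assms by (simp add: has_bochner_integral_iff)
  ultimately show ?thesis by (simp only:)
qed

text \<open>Rotating the ray of integration by an angle \<open>\<theta>\<close> below a right angle produces the factor
  \<open>cis \<theta> powr a\<close>, hence exponential decay of rate \<open>\<theta>\<close> along vertical lines.\<close>

lemma hyp_gamma_decay:
  assumes \<sigma>: "\<sigma> > 0" and \<theta>: "0 < \<theta>" "\<theta> < pi / 2"
  obtains C where "\<And>\<tau>. norm (hyp_gamma w (Complex \<sigma> \<tau>)) \<le> C * exp (- \<theta> * \<bar>\<tau>\<bar>)"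
proof -
  have bound: "norm (hyp_gamma w (Complex \<sigma> \<tau>)) \<le>
      (LINT t|halfline. t powr (\<sigma> - 1) * norm (exp_cos w (cis \<phi> * of_real t))) * exp (- \<phi> * \<tau>)"
    if \<phi>: "\<bar>\<phi>\<bar> < pi / 2" for \<phi> \<tau>
  proof -
    let ?a = "Complex \<sigma> \<tau>"
    have Re: "Re (cis \<phi>) > 0" using \<phi> by (auto intro!: cos_gt_zero_pi)
    have h: "has_bochner_integral halfline (\<lambda>t. of_real t powr (?a - 1) * exp_cos w (cis \<phi> * of_real t))
       (hyp_gamma w ?a * cis \<phi> powr (- ?a))"
      by (rule mellin_exp_cos) (use \<sigma> Re in auto)
    have Arg: "Arg (cis \<phi>) = \<phi>" using \<phi> by (intro Arg_cis) auto
    have "norm (cis \<phi> powr (- ?a)) = exp (\<tau> * \<phi>)"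
      by (simp add: norm_powr_complex Arg)
    then have "norm (hyp_gamma w ?a) * exp (\<tau> * \<phi>) = norm (hyp_gamma w ?a * cis \<phi> powr (- ?a))"
      by (simp add: norm_mult)
    also have "\<dots> \<le> (LINT t|halfline. norm (of_real t powr (?a - 1) * exp_cos w (cis \<phi> * of_real t)))"
      using h integral_norm_bound by (metis has_bochner_integral_integral_eq)
    also have "\<dots> = (LINT t|halfline. t powr (\<sigma> - 1) * norm (exp_cos w (cis \<phi> * of_real t)))"
      by (rule Bochner_Integration.integral_cong) (auto simp: norm_mult norm_powr_of_real space_restrict_space)
    finally show ?thesis by (simp add: exp_minus field_simps)
  qed
  let ?I = "\<lambda>\<phi>. LINT t|halfline. t powr (\<sigma> - 1) * norm (exp_cos w (cis \<phi> * of_real t))"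
  have I: "?I \<phi> \<ge> 0" for \<phi> by (intro integral_nonneg_AE AE_I2) auto
  show thesis
  \<comment> \<open>Non-negative \<tau> is treated by the rotation through \<theta>, negative \<tau>
    by the opposite one; the sum of the two constants serves both.\<close>
  proof (rule that[of "?I \<theta> + ?I (- \<theta>)"])
    fix \<tau>
    show "norm (hyp_gamma w (Complex \<sigma> \<tau>)) \<le> (?I \<theta> + ?I (- \<theta>)) * exp (- \<theta> * \<bar>\<tau>\<bar>)"
      using bound[of \<theta> \<tau>] bound[of "- \<theta>" \<tau>] \<theta> I[of \<theta>] I[of "- \<theta>"]
      by (cases "\<tau> \<ge> 0") (auto simp: ring_distribs intro: add_increasing add_increasing2)
  qed
qed

lemma integrable_exp_minus_abs:
  assumes "\<delta> > 0"
  shows "integrable lborel (\<lambda>t. exp (- \<delta> * \<bar>t\<bar>) :: real)"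
proof -
  let ?f = "\<lambda>t::real. indicator {0<..} t * exp (- \<delta> * t)"
  have "integrable halfline (\<lambda>t. t powr (Re 1 - 1) * exp (- \<delta> * t))"
    by (rule integrable_powr_exp_halfline) (use assms in auto)
  then have "integrable halfline (\<lambda>t. exp (- \<delta> * t))"
    by (rule integrable_eqI) (auto simp: space_restrict_space)
  then have f: "integrable lborel ?f"
    by (simp add: integrable_restrict_space set_integrable_def)
  then have "integrable lborel (\<lambda>t. ?f (0 + (-1) * t))"
    by (subst lborel_integrable_real_affine_iff) auto
  with f have "integrable lborel (\<lambda>t. ?f t + ?f (0 + (-1) * t))"
    by (rule Bochner_Integration.integrable_add)
  then show ?thesis
  proof (rule Bochner_Integration.integrable_bound)
    \<comment> \<open>At t = 0 both indicators vanish while the left side is 1, so this point is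
      removed as a null set.\<close>
    show "AE t in lborel. norm (exp (- \<delta> * \<bar>t\<bar>)) \<le> norm (?f t + ?f (0 + (-1) * t))"
      using AE_lborel_singleton[of "0 :: real"] by eventually_elim (auto simp: indicator_def)
  qed measurable
qed

text \<open>On the vertical line the power of \<open>y\<close> grows at most at the rate |Arg y|,
  which is below pi/2. A decay rate \<theta> strictly between the two leaves exponential
  decay.\<close>

lemma hyp_gamma_powr_integrable:
  assumes \<sigma>: "\<sigma> > 0" and y: "Re y > 0"
  shows "integrable lborel (\<lambda>\<tau>. hyp_gamma w (Complex \<sigma> \<tau>) * y powr (- Complex \<sigma> \<tau>))"
proof -
  have "\<bar>Arg y\<bar> < pi / 2" using Arg_Re_pos[of y] y by blast
  then obtain \<theta> where \<theta>: "\<bar>Arg y\<bar> < \<theta>" "\<theta> < pi / 2" using dense by blast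
  have "0 < \<theta>" using \<theta> by linarith
  then obtain C where C: "\<And>\<tau>. norm (hyp_gamma w (Complex \<sigma> \<tau>)) \<le> C * exp (- \<theta> * \<bar>\<tau>\<bar>)"
    using hyp_gamma_decay[OF \<sigma> _ \<theta>(2)] by metis
  have C0: "C \<ge> 0" using order_trans[OF norm_ge_zero C[of 0]] by simp
  have "integrable lborel (\<lambda>\<tau>. C * norm y powr (- \<sigma>) * exp (- (\<theta> - \<bar>Arg y\<bar>) * \<bar>\<tau>\<bar>))"
    by (intro integrable_mult_right integrable_exp_minus_abs) (use \<theta> in auto)
  then show ?thesis
  proof (rule Bochner_Integration.integrable_bound)
    have [measurable]: "(\<lambda>\<tau>. hyp_gamma w (Complex \<sigma> \<tau>)) \<in> borel_measurable borel"
      by (rule hyp_gamma_measurable_line[OF \<sigma>])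
    show "(\<lambda>\<tau>. hyp_gamma w (Complex \<sigma> \<tau>) * y powr (- Complex \<sigma> \<tau>)) \<in> borel_measurable lborel"
      by measurable
    show "AE \<tau> in lborel. norm (hyp_gamma w (Complex \<sigma> \<tau>) * y powr (- Complex \<sigma> \<tau>))
        \<le> norm (C * norm y powr (- \<sigma>) * exp (- (\<theta> - \<bar>Arg y\<bar>) * \<bar>\<tau>\<bar>))"
    proof (rule AE_I2)
      fix \<tau>
      have "norm (hyp_gamma w (Complex \<sigma> \<tau>) * y powr (- Complex \<sigma> \<tau>)) =
         norm (hyp_gamma w (Complex \<sigma> \<tau>)) * (norm y powr (- \<sigma>) * exp (\<tau> * Arg y))"
        by (simp add: norm_mult norm_powr_complex)
      also have "\<dots> \<le> (C * exp (- \<theta> * \<bar>\<tau>\<bar>)) * (norm y powr (- \<sigma>) * exp (\<bar>Arg y\<bar> * \<bar>\<tau>\<bar>))"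
        by (intro mult_mono C mult_nonneg_nonneg) (use C0 in \<open>auto simp: abs_mult[symmetric] mult.commute abs_le_iff\<close>)
      also have "\<dots> = norm (C * norm y powr (- \<sigma>) * exp (- (\<theta> - \<bar>Arg y\<bar>) * \<bar>\<tau>\<bar>))"
        using C0 by (simp add: abs_mult algebra_simps flip: exp_add)
      finally show "norm (hyp_gamma w (Complex \<sigma> \<tau>) * y powr (- Complex \<sigma> \<tau>)) \<le> \<dots>" .
    qed
  qed
qed

text \<open>From ln m \<le> m the power is at most exp(\<beta> m), which merely raises the linear
  coefficient before the square is completed. This crude bound suffices: only independence of m
  matters.\<close>

lemma powr_mult_quadratic_exp_le:
  fixes \<rho> \<kappa> \<beta> m :: real
  assumes "\<rho> > 0" "\<beta> \<ge> 0" "m > 0"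
  shows "m powr \<beta> * exp (- \<rho> * m\<^sup>2 + \<kappa> * m) \<le> exp ((\<kappa> + \<beta>)\<^sup>2 / (4 * \<rho>))"
proof -
  have "ln m \<le> m" using ln_le_minus_one[OF assms(3)] by simp
  then have "m powr \<beta> \<le> exp (\<beta> * m)"
    using assms by (simp add: powr_def mult_left_mono)
  then have "m powr \<beta> * exp (- \<rho> * m\<^sup>2 + \<kappa> * m) \<le> exp (\<beta> * m) * exp (- \<rho> * m\<^sup>2 + \<kappa> * m)"
    by (rule mult_right_mono) simp
  also have "\<dots> = exp (- \<rho> * m\<^sup>2 + (\<kappa> + \<beta>) * m)"
    by (simp add: algebra_simps flip: exp_add)
  also have "\<dots> \<le> exp ((\<kappa> + \<beta>)\<^sup>2 / (4 * \<rho>))"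
    using quadratic_le[OF assms(1), of m "\<kappa> + \<beta>"] by simp
  finally show ?thesis .
qed

lemma norm_exp_cos_of_real_le:
  assumes "t > 0"
  shows "norm (exp_cos w (y * of_real t)) \<le> exp (- Re y * t + norm (w * csqrt y) * sqrt t)"
proof -
  have "norm (exp_cos w (y * of_real t)) = exp (- Re y * t) * norm (cos (w * csqrt y * of_real (sqrt t)))"
    using assms by (simp add: exp_cos_def norm_mult csqrt_mult_of_real mult.assoc)
  also have "\<dots> \<le> exp (- Re y * t) * exp (norm (w * csqrt y * of_real (sqrt t)))"
    by (intro mult_left_mono norm_cos_le) auto
  also have "\<dots> = exp (- Re y * t + norm (w * csqrt y) * sqrt t)"
    using assms by (simp add: norm_mult flip: exp_add)
  finally show ?thesis .
qed

text \<open>With t = exp v the Mellin transform on the line Re = \<sigma> is the Fourier transform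
  of v -> exp(\<sigma> v) h(y exp v), where h is \<open>exp_cos w\<close>. The point of evaluation
  is carried by \<open>y\<close>, so inversion at v = 0 is enough.\<close>

lemma mellin_inversion_exp_cos:
  assumes \<sigma>: "\<sigma> > 0" and y: "Re y > 0"
  shows "has_bochner_integral lborel (\<lambda>\<tau>. hyp_gamma w (Complex \<sigma> \<tau>) * y powr (- Complex \<sigma> \<tau>))
           (2 * of_real pi * exp_cos w y)"
proof -
  have y0: "y \<noteq> 0" using y by auto
  define f where "f = (\<lambda>v. of_real (exp v) powr of_real \<sigma> * exp_cos w (y * of_real (exp v)))"
  let ?g = "\<lambda>\<tau> t. of_real t powr (Complex \<sigma> \<tau> - 1) * exp_cos w (y * of_real t)"
  have img: "exp ` UNIV = {0::real<..}" by (auto simp: image_iff) (metis exp_ln)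
  have mg: "?g \<tau> \<in> borel_measurable borel" "(exp :: real \<Rightarrow> real) \<in> borel_measurable borel" for \<tau>
    by measurable
  have der: "(exp has_field_derivative exp x) (at x)" for x :: real by (rule DERIV_exp)
  have inj: "inj_on exp (UNIV :: real set)" by (simp add: inj_on_def)
  have UNIV_eq: "restrict_space lborel UNIV = (lborel :: real measure)"
    by (rule measure_eqI) (auto simp: sets_restrict_space emeasure_restrict_space)
  have pw: "complex_of_real (exp v) powr of_real \<sigma> = exp (of_real \<sigma> * of_real v)" for v
    by (simp add: powr_def Ln_of_real flip: exp_of_real)
  have fe: "\<bar>exp v\<bar> *\<^sub>R ?g \<tau> (exp v) = f v * iexp (\<tau> * v)" for v \<tau>
  proof -
    have "complex_of_real (exp v) powr (Complex \<sigma> \<tau> - 1) = exp ((Complex \<sigma> \<tau> - 1) * of_real v)"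
      by (simp add: powr_def Ln_of_real flip: exp_of_real)
    moreover have "exp (of_real v) * exp ((Complex \<sigma> \<tau> - 1) * of_real v) = exp (of_real \<sigma> * of_real v) * iexp (\<tau> * v)"
      by (simp add: complex_eq_iff[of "Complex _ _"] Complex_eq algebra_simps flip: exp_add)
    ultimately show ?thesis
      unfolding f_def pw by (simp add: scaleR_conv_of_real exp_of_real[symmetric] mult_ac)
  qed
  have hbi: "has_bochner_integral lborel (\<lambda>v. f v * iexp (\<tau> * v)) (hyp_gamma w (Complex \<sigma> \<tau>) * y powr (- Complex \<sigma> \<tau>))" for \<tau>
    using mellin_exp_cos[of "Complex \<sigma> \<tau>" y w] \<sigma> y
      integrable_change_of_variables[OF mg(1)[of \<tau>] mg(2) mg(2) _ _ img inj der]
      integral_change_of_variables[OF mg(1)[of \<tau>] mg(2) mg(2) _ _ img inj der]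
    unfolding has_bochner_integral_iff fe UNIV_eq by simp
  have f: "integrable lborel f"
    using hbi[of 0] by (simp add: has_bochner_integral_iff)
  \<comment> \<open>In terms of m = sqrt(exp v) the weight is m^(2 \<sigma>) against a Gaussian in
    m, hence bounded uniformly in v.\<close>
  have bd: "norm (f v) \<le> exp ((norm (w * csqrt y) + 2 * \<sigma>)\<^sup>2 / (4 * Re y))" for v
  proof -
    let ?m = "sqrt (exp v)"
    have "norm (f v) \<le> exp v powr \<sigma> * exp (- Re y * exp v + norm (w * csqrt y) * ?m)"
      using norm_exp_cos_of_real_le[OF exp_gt_zero, of w y v]
      by (simp only: f_def norm_mult[of "_ powr _"] norm_powr_of_real[OF exp_gt_zero] Re_complex_of_real mult_left_mono powr_ge_zero)
    also have "exp v powr \<sigma> = ?m powr (2 * \<sigma>)"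
      by (simp add: powr_half_sqrt[symmetric] powr_powr)
    also have "- Re y * exp v = - Re y * ?m\<^sup>2" by simp
    also have "?m powr (2 * \<sigma>) * exp (- Re y * ?m\<^sup>2 + norm (w * csqrt y) * ?m) \<le>
      exp ((norm (w * csqrt y) + 2 * \<sigma>)\<^sup>2 / (4 * Re y))"
      by (rule powr_mult_quadratic_exp_le) (use \<sigma> y in auto)
    finally show ?thesis .
  qed
  have cont: "isCont f 0"
  proof -
    have "f = (\<lambda>v. exp (of_real \<sigma> * of_real v) * (exp (- (y * of_real (exp v))) * cos (w * (csqrt y * of_real (sqrt (exp v))))))"
      by (simp only: f_def exp_cos_def csqrt_mult_of_real[OF exp_gt_zero] pw)
    then show ?thesis by (auto intro!: continuous_intros)
  qed
  have F: "(CLINT v|lborel. f v * iexp (\<tau> * v)) = hyp_gamma w (Complex \<sigma> \<tau>) * y powr (- Complex \<sigma> \<tau>)" for \<tau>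
    using hbi[of \<tau>] by (simp add: has_bochner_integral_iff)
  have "f 0 = exp_cos w y" by (simp add: f_def)
  then show ?thesis
    using fourier_inversion_at_0[OF f bd cont, unfolded F] hyp_gamma_powr_integrable[OF \<sigma> y, of w]
    by (simp add: has_bochner_integral_iff)
qed

section \<open>The generalized Bessel function as an integral over the half-line\<close>

lemma bessel_integrand_conv_hyp_gamma:
  "bessel_integrand z w x s =
     hyp_gamma w ((s - z) / 2) * hyp_gamma w ((s + z) / 2) * 2 powr (s - 2) * x powr (- s)"
  by (simp add: bessel_integrand_def hyp_gamma_def mult_ac)

context
  fixes x :: complex
  assumes x: "x \<noteq> 0" "\<bar>Arg x\<bar> < pi / 4"
begin

lemma Re_pos_of_Arg_less: "Re x > 0"
  using x Arg_Re_pos[of x] pi_gt_zero by (auto simp del: pi_gt_zero)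

text \<open>Doubling an argument below pi/4 in modulus stays within the principal strip, and a
  positive real divisor does not move it. Later identities between powers of x^2 and of x are
  checked through this logarithm.\<close>

lemma Ln_sq_div:
  assumes "r > 0"
  shows "Ln (x\<^sup>2 / of_real r) = 2 * Ln x - of_real (ln r)"
proof (rule Ln_unique)
  show "exp (2 * Ln x - of_real (ln r)) = x\<^sup>2 / of_real r"
    using x assms by (simp add: exp_diff exp_double exp_of_real)
  have "Im (Ln x) = Arg x" using x by (simp add: Arg_eq_Im_Ln)
  then show "- pi < Im (2 * Ln x - of_real (ln r))" "Im (2 * Ln x - of_real (ln r)) \<le> pi"
    using x pi_gt_zero by auto
qed

lemma Re_sq_div_pos:
  assumes "r > 0"
  shows "Re (x\<^sup>2 / of_real r) > 0"
proof -
  have "x\<^sup>2 / of_real r \<noteq> 0" using x assms by simp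
  then have "Arg (x\<^sup>2 / of_real r) = 2 * Arg x"
    using Ln_sq_div[OF assms] x by (simp add: Arg_eq_Im_Ln)
  then have "\<bar>Arg (x\<^sup>2 / of_real r)\<bar> < pi / 2" using x by simp
  then show ?thesis using Arg_Re_pos \<open>x\<^sup>2 / of_real r \<noteq> 0\<close> by blast
qed

text \<open>The inner integral for fixed u once \<open>hyp_gamma w ((s + z) / 2)\<close> is written
  as a Mellin integral. It is the inversion formula for the other factor at y = x^2/4u, since 2^s
  x^(-s) u^((s+z)/2) equals y^(-(s-z)/2) up to factors free of s.\<close>

lemma mellin_kernel_inner:
  assumes c: "c > \<bar>Re z\<bar>" and u: "u > 0"
  shows "has_bochner_integral lborel
    (\<lambda>t. hyp_gamma w ((Complex c t - z) / 2) * 2 powr (Complex c t - 2) * x powr (- Complex c t)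
         * of_real u powr ((Complex c t + z) / 2 - 1))
    (of_real pi * ((x / 2) powr (- z) * of_real u powr (z - 1) * exp_cos w (x\<^sup>2 / of_real (4 * u))))"
proof -
  define \<sigma> where "\<sigma> = (c - Re z) / 2"
  let ?y = "x\<^sup>2 / of_real (4 * u)"
  let ?h = "\<lambda>\<tau>. hyp_gamma w (Complex \<sigma> \<tau>) * ?y powr (- Complex \<sigma> \<tau>)"
  have \<sigma>: "\<sigma> > 0" using c by (simp add: \<sigma>_def)
  have y: "Re ?y > 0" using u by (intro Re_sq_div_pos) auto
  have a: "Complex \<sigma> (- Im z / 2 + 1 / 2 * t) = (Complex c t - z) / 2" for t
    by (simp add: complex_eq_iff \<sigma>_def field_simps)
  \<comment> \<open>The affine change \<tau> = (t - Im z)/2 maps Re s = c to the line through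
    \<sigma> = (c - Re z)/2. Its factor 2 meets the 2 pi of the inversion and the 1/4 from
    \<open>2 powr (s - 2)\<close>, which leaves pi.\<close>
  have "has_bochner_integral lborel (\<lambda>t. ?h (- Im z / 2 + 1 / 2 * t)) ((2 * of_real pi * exp_cos w ?y) /\<^sub>R \<bar>1 / 2\<bar>)"
    using mellin_inversion_exp_cos[OF \<sigma> y, of w]
    by (subst lborel_has_bochner_integral_real_affine_iff[symmetric]) auto
  from has_bochner_integral_mult_right[OF this, of "1 / 4 * (x / 2) powr (- z) * of_real u powr (z - 1)"]
  show ?thesis
  proof (rule has_bochner_integral_eqI)
    fix t
    define s where "s = Complex c t"
    have Ln2: "Ln (x / 2) = Ln x - of_real (ln 2)"
      using x Ln_divide_of_real[of 2 x] by simp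
    have Lnu: "Ln (of_real u) = of_real (ln u)" using u by (simp add: Ln_of_real)
    have L2: "Ln 2 = of_real (ln 2)" using Ln_of_real[of 2] by simp
    have l4: "ln (4 * u) = 2 * ln 2 + ln u"
    proof -
      have "ln (4 :: real) = 2 * ln 2" using ln_realpow[of 2 2] by simp
      then show ?thesis using u by (simp add: ln_mult)
    qed
    have four: "(4 :: complex) = exp (2 * of_real (ln 2))"
      by (simp add: exp_double exp_of_real)
    have y0: "?y \<noteq> 0" using x u by simp
    \<comment> \<open>Every base has a logarithm that is linear in ln 2, ln u and Ln x, so the
      identity of powers reduces to comparing exponents.\<close>
    have "2 powr (s - 2) * x powr (- s) * of_real u powr ((s + z) / 2 - 1) =
      exp ((s - 2) * of_real (ln 2) - s * Ln x + ((s + z) / 2 - 1) * of_real (ln u))"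
      using x u by (simp add: powr_def Lnu L2 algebra_simps flip: exp_add)
    also have "\<dots> = exp (- (2 * of_real (ln 2)) + - z * (Ln x - of_real (ln 2)) + (z - 1) * of_real (ln u)
        + - ((s - z) / 2) * (2 * Ln x - of_real (ln (4 * u))))"
      unfolding l4 by (rule arg_cong[of _ _ exp]) (simp add: field_simps)
    also have "\<dots> = 1 / 4 * (x / 2) powr (- z) * of_real u powr (z - 1) * ?y powr (- ((s - z) / 2))"
    proof -
      have "1 / 4 = exp (- (2 * of_real (ln 2)) :: complex)" by (subst four) (simp add: exp_minus field_simps)
      moreover have "(x / 2) powr (- z) = exp (- z * (Ln x - of_real (ln 2)))"
        using x by (simp add: powr_def Ln2)
      moreover have "of_real u powr (z - 1) = exp ((z - 1) * of_real (ln u))"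
        using u by (simp add: powr_def Lnu)
      moreover have "?y powr (- ((s - z) / 2)) = exp (- ((s - z) / 2) * (2 * Ln x - of_real (ln (4 * u))))"
        using y0 u unfolding powr_def by (subst Ln_sq_div) auto
      ultimately show ?thesis by (simp only: exp_add)
    qed
    finally show "hyp_gamma w ((Complex c t - z) / 2) * 2 powr (Complex c t - 2) * x powr (- Complex c t)
         * of_real u powr ((Complex c t + z) / 2 - 1) =
         1 / 4 * (x / 2) powr (- z) * of_real u powr (z - 1) * ?h (- Im z / 2 + 1 / 2 * t)"
      unfolding a s_def by (simp add: mult_ac)
  qed (simp add: scaleR_conv_of_real)
qed

text \<open>On the line the modulus of u^((s+z)/2 - 1) does not depend on t, so the double integral
  of the norms factors and Fubini applies. The condition on \<open>c\<close> serves twice: c - Re z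
  > 0 for the inversion, c + Re z > 0 for the Mellin integral.\<close>

lemma bessel_line_integral:
  assumes c: "c > \<bar>Re z\<bar>"
  shows "has_bochner_integral lborel (\<lambda>t. bessel_integrand z w x (Complex c t))
     (of_real pi * (x / 2) powr (- z) *
       (CLINT u|halfline. of_real u powr (z - 1) * exp_cos w (of_real u) * exp_cos w (x\<^sup>2 / of_real (4 * u))))"
proof -
  interpret sigma_finite_measure halfline by (rule sigma_finite_halfline)
  interpret P: pair_sigma_finite lborel halfline ..
  let ?N = "\<lambda>t. hyp_gamma w ((Complex c t - z) / 2) * 2 powr (Complex c t - 2) * x powr (- Complex c t)"
  let ?m = "\<lambda>t u. of_real u powr ((Complex c t + z) / 2 - 1)"
  let ?h = "\<lambda>t u. ?N t * ?m t u * exp_cos w (of_real u)"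
  have a: "(Complex c t - z) / 2 = Complex ((c - Re z) / 2) ((t - Im z) / 2)"
    "(Complex c t + z) / 2 = Complex ((c + Re z) / 2) ((t + Im z) / 2)" for t
    by (auto simp: complex_eq_iff)
  have [measurable]: "(\<lambda>\<tau>. hyp_gamma w (Complex ((c - Re z) / 2) \<tau>)) \<in> borel_measurable borel"
    by (rule hyp_gamma_measurable_line) (use c in auto)
  have [measurable]: "(\<lambda>p. snd p) \<in> borel_measurable (lborel \<Otimes>\<^sub>M halfline)"
    by (rule measurable_compose[OF measurable_snd]) measurable
  have Nm [measurable]: "?N \<in> borel_measurable borel" unfolding a by measurable
  have hm: "(\<lambda>(t, u). ?h t u) \<in> borel_measurable (lborel \<Otimes>\<^sub>M halfline)"
    by measurable
  have N: "integrable lborel ?N"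
    using mellin_kernel_inner[OF c, of 1 w] by (simp add: has_bochner_integral_iff)
  have mel: "has_bochner_integral halfline (\<lambda>u. ?m t u * exp_cos w (of_real u)) (hyp_gamma w ((Complex c t + z) / 2))" for t
    using mellin_exp_cos[of "(Complex c t + z) / 2" 1 w] c by simp
  have inner_eq: "(CLINT u|halfline. ?h t u) = bessel_integrand z w x (Complex c t)" for t
  proof -
    have "(CLINT u|halfline. ?h t u) = (CLINT u|halfline. ?N t * (?m t u * exp_cos w (of_real u)))"
      by (simp only: mult.assoc)
    also have "\<dots> = ?N t * (CLINT u|halfline. ?m t u * exp_cos w (of_real u))"
      by (rule integral_mult_right_zero)
    also have "(CLINT u|halfline. ?m t u * exp_cos w (of_real u)) = hyp_gamma w ((Complex c t + z) / 2)"
      using mel[of t] by (simp only: has_bochner_integral_iff)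
    finally show ?thesis by (simp add: bessel_integrand_conv_hyp_gamma mult_ac)
  qed
  have nm: "norm (?m t u) = u powr ((c + Re z) / 2 - 1)" if "u > 0" for t u
    using that by (simp add: norm_powr_of_real)
  let ?I = "LINT u|halfline. u powr ((c + Re z) / 2 - 1) * norm (exp_cos w (of_real u))"
  have int: "integrable (lborel \<Otimes>\<^sub>M halfline) (\<lambda>(t, u). ?h t u)"
  proof (rule P.Fubini_integrable[OF hm])
    have "(LINT u|halfline. norm (?h t u)) = norm (?N t) * ?I" for t
    proof -
      have "(LINT u|halfline. norm (?h t u)) = (LINT u|halfline. norm (?N t) * (u powr ((c + Re z) / 2 - 1) * norm (exp_cos w (of_real u))))"
        by (rule Bochner_Integration.integral_cong) (auto simp: norm_mult nm space_restrict_space)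
      then show ?thesis by simp
    qed
    then show "integrable lborel (\<lambda>t. LINT u|halfline. norm (case (t, u) of (t, u) \<Rightarrow> ?h t u))"
      using integrable_mult_left[OF integrable_norm[OF N], of ?I] by simp
    have "integrable halfline (\<lambda>u. ?N t * (?m t u * exp_cos w (of_real u)))" for t
      using mel[of t] by (intro integrable_mult_right) (auto simp: has_bochner_integral_iff)
    then show "AE t in lborel. integrable halfline (\<lambda>u. case (t, u) of (t, u) \<Rightarrow> ?h t u)"
      by (intro AE_I2) (simp add: mult.assoc)
  qed
  have "integrable lborel (\<lambda>t. CLINT u|halfline. ?h t u)"
    using P.integrable_fst[OF int] by simp
  moreover have "(CLINT t|lborel. CLINT u|halfline. ?h t u) = (CLINT u|halfline. CLINT t|lborel. ?h t u)"
    using P.Fubini_integral[OF int] by simp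
  moreover have "(CLINT u|halfline. CLINT t|lborel. ?h t u) = (CLINT u|halfline. (of_real pi * (x / 2) powr (- z)) *
       (of_real u powr (z - 1) * exp_cos w (of_real u) * exp_cos w (x\<^sup>2 / of_real (4 * u))))"
  proof (rule Bochner_Integration.integral_cong[OF refl])
    fix u assume "u \<in> space halfline"
    then have "u > 0" by (simp add: space_restrict_space)
    from mellin_kernel_inner[OF c this, of w]
    show "(CLINT t|lborel. ?h t u) = (of_real pi * (x / 2) powr (- z)) *
       (of_real u powr (z - 1) * exp_cos w (of_real u) * exp_cos w (x\<^sup>2 / of_real (4 * u)))"
      by (simp add: has_bochner_integral_iff mult_ac)
  qed
  ultimately show ?thesis by (simp add: inner_eq has_bochner_integral_iff)
qed

text \<open>The line integral has been evaluated to an expression free of c, so the description in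
  \<open>gen_bessel_K\<close> has a value; the integral on a single line already determines
  it.\<close>

lemma gen_bessel_K_eq:
  "gen_bessel_K z w x = 1 / 2 * (x / 2) powr (- z) *
     (CLINT u|halfline. of_real u powr (z - 1) * exp_cos w (of_real u) * exp_cos w (x\<^sup>2 / of_real (4 * u)))"
  (is "_ = ?K")
proof -
  have K: "has_bochner_integral lborel
          (\<lambda>t. 1 / (2 * of_real pi * \<i>) * (bessel_integrand z w x (Complex c t) * \<i>)) ?K"
    if "c > \<bar>Re z\<bar>" for c
    using has_bochner_integral_mult_right[OF bessel_line_integral[OF that, of w], of "1 / (2 * of_real pi)"]
    by (rule has_bochner_integral_eqI) auto
  show ?thesis
    unfolding gen_bessel_K_def
  proof (rule the_equality)
    show "\<forall>c>\<bar>Re z\<bar>. has_bochner_integral lborel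
          (\<lambda>t. 1 / (2 * of_real pi * \<i>) * (bessel_integrand z w x (Complex c t) * \<i>)) ?K"
      using K by blast
  next
    fix K assume *: "\<forall>c>\<bar>Re z\<bar>. has_bochner_integral lborel
          (\<lambda>t. 1 / (2 * of_real pi * \<i>) * (bessel_integrand z w x (Complex c t) * \<i>)) K"
    show "K = ?K"
      by (rule has_bochner_integral_eq[OF *[rule_format, of "\<bar>Re z\<bar> + 1"] K[of "\<bar>Re z\<bar> + 1"]]) auto
  qed
qed

end

section \<open>Theta transformation\<close>

lemma sum_symmetric_int_interval:
  fixes f :: "int \<Rightarrow> 'a::comm_monoid_add"
  shows "(\<Sum>k\<in>{-int N..int N}. f k) = f 0 + (\<Sum>n<N. f (int (Suc n)) + f (- int (Suc n)))"
proof (induction N)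
  case (Suc N)
  have "{-int (Suc N)..int (Suc N)} = insert (int (Suc N)) (insert (- int (Suc N)) {-int N..int N})"
    by auto
  then show ?case using Suc by (simp add: algebra_simps)
qed simp

lemma sum_int_telescope:
  fixes h :: "int \<Rightarrow> 'a::ab_group_add"
  shows "(\<Sum>k\<in>{-int N..int N}. h (k + 1) - h k) = h (int N + 1) - h (- int N)"
  unfolding sum_symmetric_int_interval by (induction N) (auto simp: algebra_simps)

lemma entire_primitive:
  assumes "g holomorphic_on UNIV"
  obtains P where "\<And>z. (P has_field_derivative g z) (at z)"
  using holomorphic_convex_primitive'[of UNIV g] assms by auto

lemma has_integral_complex_primitive:
  fixes P g :: "complex \<Rightarrow> complex"
  assumes P: "\<And>v. v \<in> {a..b} \<Longrightarrow> (P has_field_derivative g (of_real v)) (at (of_real v))" and "a \<le> b"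
  shows "((\<lambda>v. g (of_real v)) has_integral (P (of_real b) - P (of_real a))) {a..b}"
proof -
  have "((\<lambda>x. P (of_real x)) has_vector_derivative g (of_real v)) (at v within {a..b})" if "v \<in> {a..b}" for v
    using has_vector_derivative_real_field[OF P[OF that]] by (simp add: has_vector_derivative_at_within o_def)
  then show ?thesis
    using fundamental_theorem_of_calculus[OF \<open>a \<le> b\<close>, of "\<lambda>x. P (of_real x)" "\<lambda>v. g (of_real v)"] by auto
qed

text \<open>For a primitive P the left side is P(c + pi) - P(c - pi), and its derivative in c is g(c
  + pi) - g(c - pi) = 0. The shift c is complex, so this takes the place of an argument with
  rectangular contours.\<close>

lemma integral_periodic_shift:
  assumes g: "g holomorphic_on UNIV" and per: "\<And>z. g (z + 2 * of_real pi) = g z"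
  shows "integral {-pi..pi} (\<lambda>v. g (of_real v + c)) = integral {-pi..pi} (\<lambda>v. g (of_real v))"
proof -
  obtain P where P: "\<And>z. (P has_field_derivative g z) (at z)"
    using entire_primitive[OF g] by metis
  define Q where "Q = (\<lambda>c. P (c + of_real pi) - P (c + of_real (- pi)))"
  have Pc: "((\<lambda>z. P (z + c)) has_field_derivative g (z + c)) (at z)" for z c
    using P DERIV_shift by blast
  have Q: "integral {-pi..pi} (\<lambda>v. g (of_real v + c)) = Q c" for c
    using has_integral_complex_primitive[where P = "\<lambda>z. P (z + c)" and g = "\<lambda>z. g (z + c)", OF Pc, of "-pi" pi]
    by (simp add: Q_def integral_unique add.commute)
  have "(Q has_field_derivative 0) (at c)" for c
  proof -
    have "(Q has_field_derivative (g (c + of_real pi) - g (c + of_real (- pi)))) (at c)"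
      unfolding Q_def using Pc by (intro DERIV_diff)
    moreover have "g (c + of_real pi) = g (c + of_real (- pi))"
      using per[of "c + of_real (- pi)"] by (simp add: algebra_simps)
    ultimately show ?thesis by simp
  qed
  then have "Q c = Q 0"
    using has_field_derivative_zero_constant[of UNIV Q] by (metis UNIV_I convex_UNIV)
  then show ?thesis using Q[of c] Q[of 0] by simp
qed

text \<open>One integration by parts. The boundary terms are bounded instead of cancelled, since
  \<open>G\<close> need not be periodic; decay like 1/|m| is all that the end terms of a telescoping
  sum require.\<close>

lemma fourier_coefficient_bound:
  assumes G: "G holomorphic_on S" and S: "open S" "of_real ` {-pi..pi} \<subseteq> S"
  obtains C where "\<And>m::int. m \<noteq> 0 \<Longrightarrow> 
    norm (integral {-pi..pi} (\<lambda>v. G (of_real v) * exp (- (\<i> * of_int m * of_real v)))) \<le> C / \<bar>of_int m\<bar>"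
proof -
  have dG: "(G has_field_derivative deriv G (of_real v)) (at (of_real v))" if "v \<in> {-pi..pi}" for v
    using holomorphic_derivI[OF G S(1)] S(2) that by (meson imageI subsetD)
  have contG: "continuous_on {-pi..pi} (\<lambda>v. G (of_real v))"
    using continuous_on_compose2[OF holomorphic_on_imp_continuous_on[OF G] _ S(2)]
    by (simp add: continuous_intros)
  have contG': "continuous_on {-pi..pi} (\<lambda>v. deriv G (of_real v))"
    using continuous_on_compose2[OF holomorphic_on_imp_continuous_on[OF holomorphic_deriv[OF G S(1)]] _ S(2)]
    by (simp add: continuous_intros)
  obtain B where B: "\<And>v. v \<in> {-pi..pi} \<Longrightarrow> norm (G (of_real v)) \<le> B"
    using compact_imp_bounded[OF compact_continuous_image[OF contG]] unfolding bounded_iff by fastforce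
  obtain B' where B': "\<And>v. v \<in> {-pi..pi} \<Longrightarrow> norm (deriv G (of_real v)) \<le> B'"
    using compact_imp_bounded[OF compact_continuous_image[OF contG']] unfolding bounded_iff by fastforce
  show thesis
  proof (rule that[of "2 * B + B' * (2 * pi)"])
    fix m :: int assume m: "m \<noteq> 0"
    let ?e = "\<lambda>v. exp (- (\<i> * of_int m * v))"
    let ?I = "integral {-pi..pi} (\<lambda>v. G (of_real v) * ?e (of_real v))"
    let ?I' = "integral {-pi..pi} (\<lambda>v. deriv G (of_real v) * ?e (of_real v))"
    have int: "(\<lambda>v. G (of_real v) * ?e (of_real v)) integrable_on {-pi..pi}"
      "(\<lambda>v. deriv G (of_real v) * ?e (of_real v)) integrable_on {-pi..pi}"
      by (auto intro!: integrable_continuous_interval continuous_intros contG contG')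
    have ft: "((\<lambda>v. deriv G (of_real v) * ?e (of_real v) - \<i> * of_int m * (G (of_real v) * ?e (of_real v)))
       has_integral (G (of_real pi) * ?e (of_real pi) - G (of_real (-pi)) * ?e (of_real (-pi)))) {-pi..pi}"
      by (rule has_integral_complex_primitive[where P = "\<lambda>v. G v * ?e v" and
           g = "\<lambda>v. deriv G v * ?e v - \<i> * of_int m * (G v * ?e v)"])
         (auto intro!: derivative_eq_intros dG)
    have "?I' - \<i> * of_int m * ?I = G (of_real pi) * ?e (of_real pi) - G (of_real (-pi)) * ?e (of_real (-pi))"
      using has_integral_diff[OF integrable_integral[OF int(2)]
        has_integral_mult_right[OF integrable_integral[OF int(1)], of "\<i> * of_int m"]] ft
      by (rule has_integral_unique)
    then have "norm (\<i> * of_int m * ?I) = norm (?I' - G (of_real pi) * ?e (of_real pi) + G (of_real (-pi)) * ?e (of_real (-pi)))"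
      by (simp add: algebra_simps)
    also have "\<dots> \<le> norm ?I' + norm (G (of_real pi) * ?e (of_real pi)) + norm (G (of_real (-pi)) * ?e (of_real (-pi)))"
      by (intro order_trans[OF norm_triangle_ineq] add_mono norm_triangle_ineq4 order_refl)
    also have "norm (G (of_real pi) * ?e (of_real pi)) \<le> B"
      using B[of pi] by (simp add: norm_mult)
    also have "norm (G (of_real (-pi)) * ?e (of_real (-pi))) \<le> B"
      using B[of "-pi"] by (simp add: norm_mult)
    also have "norm ?I' \<le> B' * (2 * pi)"
    proof -
      have "continuous_on {-pi..pi} (\<lambda>v. deriv G (of_real v) * ?e (of_real v))"
        by (intro continuous_intros contG')
      from integral_bound[OF _ this, of B'] B' show ?thesis
        by (simp add: norm_mult)
    qed
    finally have "\<bar>of_int m\<bar> * norm ?I \<le> 2 * B + B' * (2 * pi)"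
      by (simp add: norm_mult)
    then show "norm ?I \<le> (2 * B + B' * (2 * pi)) / \<bar>of_int m\<bar>"
      using m by (simp add: field_simps)
  qed
qed

text \<open>Dividing \<open>F v - F 0\<close> by \<open>exp (\<i> v) - 1\<close> turns the symmetric partial sums of the Fourier
  series at 0 into a telescoping sum.\<close>

lemma fourier_series_at_0:
  assumes F: "F holomorphic_on UNIV" and per: "\<And>z. F (z + 2 * of_real pi) = F z"
  shows "(\<lambda>N. \<Sum>m\<in>{-int N..int N}. integral {-pi..pi} (\<lambda>v. F (of_real v) * exp (- (\<i> * of_int m * of_real v))))
     \<longlonglongrightarrow> 2 * of_real pi * F 0"
proof -
  \<comment> \<open>In this strip exp(i z) - 1 vanishes only at 0, and the period interval lies
    inside it with room to spare.\<close>
  define S where "S = {z. \<bar>Re z\<bar> < 2 * pi}"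
  have S: "open S"
    unfolding S_def by (intro open_Collect_less continuous_intros)
  have sub: "of_real ` {-pi..pi} \<subseteq> S" unfolding S_def using pi_gt_zero by (auto simp del: pi_gt_zero)
  \<comment> \<open>Both difference quotients are completed by their derivatives at 0, so that k/l
    is (F - F 0)/(exp(i z) - 1) with the singularity removed.\<close>
  define k where "k = (\<lambda>z. if z = 0 then deriv F 0 else (F z - F 0) / (z - 0))"
  define l where "l = (\<lambda>z. if z = 0 then deriv (\<lambda>z. exp (\<i> * z)) 0 else (exp (\<i> * z) - exp (\<i> * 0)) / (z - 0))"
  have k: "k holomorphic_on S"
    unfolding k_def by (rule pole_lemma_open[OF _ S]) (use F in \<open>auto intro: holomorphic_on_subset\<close>)
  have l: "l holomorphic_on S"
    unfolding l_def by (rule pole_lemma_open[OF _ S]) (auto intro!: holomorphic_intros)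
  have l0: "l z \<noteq> 0" if "z \<in> S" for z
  proof (cases "z = 0")
    case True
    have "((\<lambda>z. exp (\<i> * z)) has_field_derivative \<i>) (at 0)"
      by (auto intro!: derivative_eq_intros)
    then show ?thesis using True by (simp add: l_def DERIV_imp_deriv)
  next
    case False
    have "exp (\<i> * z) \<noteq> 1"
    proof
      assume "exp (\<i> * z) = 1"
      then obtain n :: int where n: "Im z = 0" "Re z = of_int (2 * n) * pi"
        by (auto simp: exp_eq_1)
      then have "\<bar>real_of_int n\<bar> < 1" using that by (simp add: S_def abs_mult)
      then have "n = 0" by linarith
      then show False using n False by (simp add: complex_eq_iff)
    qed
    then show ?thesis using False by (simp add: l_def)
  qed
  define G where "G = (\<lambda>z. k z / l z)"
  have G: "G holomorphic_on S" unfolding G_def by (intro holomorphic_intros k l) (use l0 in auto)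
  have FG: "F z = F 0 + G z * (exp (\<i> * z) - 1)" if "z \<in> S" for z
    using l0[OF that] by (cases "z = 0") (auto simp: G_def k_def l_def field_simps)
  have contG: "continuous_on {-pi..pi} (\<lambda>v. G (of_real v))"
    using continuous_on_compose2[OF holomorphic_on_imp_continuous_on[OF G] _ sub]
    by (simp add: continuous_intros)
  define e where "e = (\<lambda>m v. exp (- (\<i> * of_int m * complex_of_real v)))"
  define I where "I = (\<lambda>m. integral {-pi..pi} (\<lambda>v. G (of_real v) * e m v))"
  have inte: "integral {-pi..pi} (e m) = (if m = 0 then 2 * of_real pi else 0)" for m
  proof (cases "m = 0")
    case False
    have "((\<lambda>v. exp (- (\<i> * of_int m * complex_of_real v))) has_integral
       (exp (- (\<i> * of_int m * of_real pi)) / (- (\<i> * of_int m)) - exp (- (\<i> * of_int m * of_real (- pi))) / (- (\<i> * of_int m)))) {-pi..pi}"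
      by (rule has_integral_complex_primitive[where P = "\<lambda>v. exp (- (\<i> * of_int m * v)) / (- (\<i> * of_int m))" and
           g = "\<lambda>v. exp (- (\<i> * of_int m * v))"])
         (use False in \<open>auto intro!: derivative_eq_intros\<close>)
    moreover have "exp (- (\<i> * of_int m * of_real pi)) = exp (- (\<i> * of_int m * of_real (- pi)))"
    proof -
      have "exp (\<i> * of_int m * of_real pi) = exp (- (\<i> * of_int m * of_real pi) + 2 * of_int m * of_real pi * \<i>)"
        by (simp add: algebra_simps)
      also have "\<dots> = exp (- (\<i> * of_int m * of_real pi)) * exp (2 * of_int m * of_real pi * \<i>)"
        by (rule exp_add)
      also have "exp (2 * of_int m * of_real pi * \<i>) = 1"
        using exp_integer_2pi[of "of_int m"] by (simp add: mult_ac)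
      finally show ?thesis by simp
    qed
    ultimately show ?thesis using False by (simp add: e_def[abs_def] integral_unique)
  qed (simp add: e_def scaleR_conv_of_real)
  \<comment> \<open>Multiplication by exp(i v) lowers the index m by one, so the factor exp(i v) - 1
    becomes a difference of consecutive coefficients of \<open>G\<close>.\<close>
  have eq: "integral {-pi..pi} (\<lambda>v. F (of_real v) * exp (- (\<i> * of_int m * of_real v)))
     = (if m = 0 then 2 * of_real pi * F 0 else 0) + (I (m - 1) - I m)" for m
  proof -
    have "integral {-pi..pi} (\<lambda>v. F (of_real v) * exp (- (\<i> * of_int m * of_real v))) =
      integral {-pi..pi} (\<lambda>v. F 0 * e m v + (G (of_real v) * e (m - 1) v - G (of_real v) * e m v))"
    proof (rule Henstock_Kurzweil_Integration.integral_cong)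
      fix v assume v: "v \<in> {-pi..pi}"
      then have "complex_of_real v \<in> S" using sub by auto
      have "e (m - 1) v = exp (\<i> * of_real v) * e m v"
        by (simp add: e_def algebra_simps flip: exp_add)
      then show "F (of_real v) * exp (- (\<i> * of_int m * of_real v)) =
         F 0 * e m v + (G (of_real v) * e (m - 1) v - G (of_real v) * e m v)"
        unfolding FG[OF \<open>complex_of_real v \<in> S\<close>] by (simp add: e_def algebra_simps)
    qed
    also have "\<dots> = F 0 * integral {-pi..pi} (e m) + (I (m - 1) - I m)"
    proof -
      have "(\<lambda>v. F 0 * e m v) integrable_on {-pi..pi}" "(\<lambda>v. G (of_real v) * e m v) integrable_on {-pi..pi}"
        "(\<lambda>v. G (of_real v) * e (m - 1) v) integrable_on {-pi..pi}"
        unfolding e_def by (auto intro!: integrable_continuous_interval continuous_intros contG)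
      then show ?thesis
        by (simp add: I_def integral_add integral_diff integrable_diff)
    qed
    finally show ?thesis by (simp add: inte)
  qed
  obtain C where C: "\<And>m. m \<noteq> 0 \<Longrightarrow> norm (I m) \<le> C / \<bar>of_int m\<bar>"
    using fourier_coefficient_bound[OF G S sub] unfolding I_def e_def by metis
  \<comment> \<open>These are the two ends left over by the telescoping. Index 0 is not covered by
    the bound on \<open>I\<close>, hence the passage to \<open>Suc N\<close> in the first
    limit.\<close>
  have lim: "(\<lambda>N. I (int N)) \<longlonglongrightarrow> 0" "(\<lambda>N. I (- int N - 1)) \<longlonglongrightarrow> 0"
  proof -
    have lim0: "(\<lambda>N. C / (real N + 1)) \<longlonglongrightarrow> 0" by real_asymp
    have "norm (I (int (Suc N))) \<le> C / (real N + 1)" for N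
      using C[of "int (Suc N)"] by (simp add: add.commute)
    then have "\<forall>N. norm (I (int (Suc N))) \<le> C / (real N + 1)" by blast
    from Lim_null_comparison[OF always_eventually[OF this] lim0]
    show "(\<lambda>N. I (int N)) \<longlonglongrightarrow> 0" by (rule filterlim_sequentially_Suc[THEN iffD1])
    have "norm (I (- int N - 1)) \<le> C / (real N + 1)" for N
      using C[of "- int N - 1"] by (simp add: abs_if add.commute)
    then have "\<forall>N. norm (I (- int N - 1)) \<le> C / (real N + 1)" by blast
    from Lim_null_comparison[OF always_eventually[OF this] lim0]
    show "(\<lambda>N. I (- int N - 1)) \<longlonglongrightarrow> 0" .
  qed
  have "(\<Sum>m\<in>{-int N..int N}. integral {-pi..pi} (\<lambda>v. F (of_real v) * exp (- (\<i> * of_int m * of_real v))))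
     = 2 * of_real pi * F 0 + (I (- int N - 1) - I (int N))" for N
    unfolding eq sum.distrib using sum_int_telescope[of "\<lambda>k. - I (k - 1)" N]
    by (simp add: algebra_simps)
  then show ?thesis using tendsto_add[OF tendsto_const[of "2 * of_real pi * F 0"] tendsto_diff[OF lim(2,1)]]
    by simp
qed

text \<open>Translation by z multiplies the m-th coefficient by exp(i m z), by invariance of
  integrals over a period. This holds for complex z, which matters because the theta identity is
  used at a complex B.\<close>

lemma fourier_series_symmetric:
  assumes F: "F holomorphic_on UNIV" and per: "\<And>z. F (z + 2 * of_real pi) = F z"
  shows "(\<lambda>N. \<Sum>m\<in>{-int N..int N}. exp (\<i> * of_int m * z) * 
             integral {-pi..pi} (\<lambda>v. F (of_real v) * exp (- (\<i> * of_int m * of_real v))))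
     \<longlonglongrightarrow> 2 * of_real pi * F z"
proof -
  have hol: "(\<lambda>v. F (v + z)) holomorphic_on UNIV"
    by (rule holomorphic_on_compose_gen[OF _ F, unfolded o_def]) (auto intro!: holomorphic_intros)
  have per': "F (v + 2 * of_real pi + z) = F (v + z)" for v
    using per[of "v + z"] by (simp add: algebra_simps)
  have "integral {-pi..pi} (\<lambda>v. F (of_real v + z) * exp (- (\<i> * of_int m * of_real v))) = 
    exp (\<i> * of_int m * z) * integral {-pi..pi} (\<lambda>v. F (of_real v) * exp (- (\<i> * of_int m * of_real v)))" for m
  proof -
    let ?g = "\<lambda>v. F v * exp (- (\<i> * of_int m * v))"
    have g: "?g holomorphic_on UNIV" by (intro holomorphic_intros F)
    have gper: "?g (v + 2 * of_real pi) = ?g v" for v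
    proof -
      have "exp (- (\<i> * of_int m * (v + 2 * of_real pi))) = exp (- (\<i> * of_int m * v) + 2 * of_int (- m) * of_real pi * \<i>)"
        by (simp add: algebra_simps)
      also have "\<dots> = exp (- (\<i> * of_int m * v)) * exp (2 * of_int (- m) * of_real pi * \<i>)"
        by (rule exp_add)
      also have "exp (2 * of_int (- m) * of_real pi * \<i>) = 1"
        using exp_integer_2pi[of "of_int (- m)"] by (simp add: mult_ac)
      finally show ?thesis by (simp add: per)
    qed
    have "integral {-pi..pi} (\<lambda>v. F (of_real v + z) * exp (- (\<i> * of_int m * of_real v))) =
      integral {-pi..pi} (\<lambda>v. exp (\<i> * of_int m * z) * ?g (of_real v + z))"
      by (rule Henstock_Kurzweil_Integration.integral_cong) (simp add: algebra_simps flip: exp_add)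
    also have "\<dots> = exp (\<i> * of_int m * z) * integral {-pi..pi} (\<lambda>v. ?g (of_real v + z))"
      by simp
    finally show ?thesis unfolding integral_periodic_shift[OF g gper] .
  qed
  then show ?thesis using fourier_series_at_0[OF hol per'] by simp
qed

section \<open>The 2 pi-periodic sum of translates of exp(-c v^2)\<close>

context
  fixes c :: complex
  assumes c: "Re c > 0"
begin

definition theta_term :: "complex \<Rightarrow> int \<Rightarrow> complex" where
  "theta_term v k = exp (- c * (v + 2 * of_real pi * of_int k)\<^sup>2)"

definition theta_pair :: "complex \<Rightarrow> nat \<Rightarrow> complex" where
  "theta_pair v n = theta_term v (int (Suc n)) + theta_term v (- int (Suc n))"

definition theta_sum :: "complex \<Rightarrow> complex" where
  "theta_sum v = theta_term v 0 + (\<Sum>n. theta_pair v n)"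

text \<open>For bounded v the exponent is at most -Re c s^2 plus a linear term in s = 2 pi |k|.
  Setting aside one further s before completing the square leaves exp(-s), and s \<ge> |k| gives a
  geometric majorant.\<close>

lemma theta_term_bound:
  obtains K where "\<And>v k. norm v \<le> R \<Longrightarrow> norm (theta_term v k) \<le> K * exp (- 1) ^ nat \<bar>k\<bar>"
proof
  fix v :: complex and k :: int assume v: "norm v \<le> R"
  define s where "s = 2 * pi * \<bar>real_of_int k\<bar>"
  define \<kappa> where "\<kappa> = 2 * norm c * R"
  have R: "R \<ge> 0" using v norm_ge_zero order_trans by blast
  have s: "complex_of_real (2 * pi * of_int k) = 2 * of_real pi * of_int k" "norm (complex_of_real (2 * pi * of_int k)) = s"
    "(2 * pi * real_of_int k)\<^sup>2 = s\<^sup>2" "s \<ge> 0"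
    by (auto simp: s_def abs_mult power_mult_distrib norm_mult)
  let ?y = "complex_of_real (2 * pi * of_int k)"
  have "- c * (v + ?y)\<^sup>2 = - c * ?y\<^sup>2 + (- c * v\<^sup>2 - 2 * c * v * ?y)"
    by (simp add: power2_eq_square algebra_simps)
  then have "Re (- c * (v + ?y)\<^sup>2) = - Re c * s\<^sup>2 + Re (- c * v\<^sup>2 - 2 * c * v * ?y)"
    unfolding s(3)[symmetric] by (simp flip: of_real_power)
  also have "Re (- c * v\<^sup>2 - 2 * c * v * ?y) \<le> norm (- c * v\<^sup>2) + norm (2 * c * v * ?y)"
    by (rule order_trans[OF complex_Re_le_cmod norm_triangle_ineq4])
  also have "norm (- c * v\<^sup>2) \<le> norm c * R\<^sup>2"
    using v by (simp add: norm_mult norm_power mult_left_mono power_mono)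
  also have "norm (2 * c * v * ?y) \<le> \<kappa> * s"
    unfolding norm_mult s(2) \<kappa>_def using v s(4) by (intro mult_right_mono) (auto intro: mult_left_mono)
  also have "- Re c * s\<^sup>2 + (norm c * R\<^sup>2 + \<kappa> * s) = (- Re c * s\<^sup>2 + (\<kappa> + 1) * s) + norm c * R\<^sup>2 - s"
    by (simp add: algebra_simps)
  also have "\<dots> \<le> (\<kappa> + 1)\<^sup>2 / (4 * Re c) + norm c * R\<^sup>2 - s"
    using quadratic_le[OF c, of s "\<kappa> + 1"] by simp
  also have "\<dots> \<le> (\<kappa> + 1)\<^sup>2 / (4 * Re c) + norm c * R\<^sup>2 - \<bar>of_int k\<bar>"
  proof -
    have "1 * \<bar>real_of_int k\<bar> \<le> 2 * pi * \<bar>real_of_int k\<bar>" using pi_gt3 by (intro mult_right_mono) auto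
    then show ?thesis by (simp add: s_def)
  qed
  finally have "norm (theta_term v k) \<le> exp ((\<kappa> + 1)\<^sup>2 / (4 * Re c) + norm c * R\<^sup>2 - \<bar>of_int k\<bar>)"
    unfolding theta_term_def s(1)[symmetric] by simp
  also have "\<dots> = exp ((\<kappa> + 1)\<^sup>2 / (4 * Re c) + norm c * R\<^sup>2) * exp (- 1) ^ nat \<bar>k\<bar>"
    by (simp add: exp_diff exp_minus field_simps flip: exp_of_nat_mult)
  finally show "norm (theta_term v k) \<le> exp ((2 * norm c * R + 1)\<^sup>2 / (4 * Re c) + norm c * R\<^sup>2) * exp (- 1) ^ nat \<bar>k\<bar>"
    by (simp add: \<kappa>_def)
qed

lemma theta_sum_partial: "(\<Sum>k\<in>{-int N..int N}. theta_term v k) = theta_term v 0 + (\<Sum>n<N. theta_pair v n)"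
  by (simp add: sum_symmetric_int_interval theta_pair_def)

lemma theta_pair_bound:
  obtains M where "summable M" "\<And>v n. norm v \<le> R \<Longrightarrow> norm (theta_pair v n) \<le> M n"
proof -
  obtain K where K: "\<And>v k. norm v \<le> R \<Longrightarrow> norm (theta_term v k) \<le> K * exp (- 1) ^ nat \<bar>k\<bar>"
    using theta_term_bound by metis
  have "norm (theta_pair v n) \<le> 2 * K * exp (- 1) ^ Suc n" if "norm v \<le> R" for v n
    using norm_triangle_le[OF add_mono[OF K[OF that, of "int (Suc n)"] K[OF that, of "- int (Suc n)"]]]
    by (simp add: theta_pair_def nat_add_distrib)
  moreover have "summable (\<lambda>n. 2 * K * exp (- 1 :: real) ^ Suc n)"
    by (intro summable_mult summable_ignore_initial_segment[of _ 1, simplified] summable_geometric) simp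
  ultimately show thesis using that by blast
qed

lemma theta_sum_uniform_limit:
  "uniform_limit (cball 0 R) (\<lambda>N v. \<Sum>k\<in>{-int N..int N}. theta_term v k) theta_sum sequentially"
proof -
  obtain M where M: "summable M" "\<And>v n. norm v \<le> R \<Longrightarrow> norm (theta_pair v n) \<le> M n"
    using theta_pair_bound by metis
  have "uniform_limit (cball 0 R) (\<lambda>N v. \<Sum>n<N. theta_pair v n) (\<lambda>v. \<Sum>n. theta_pair v n) sequentially"
    by (rule Weierstrass_m_test) (use M in auto)
  then show ?thesis
    unfolding theta_sum_partial theta_sum_def[abs_def] by (intro uniform_limit_intros)
qed

lemma theta_sum_LIMSEQ: "(\<lambda>N. \<Sum>k\<in>{-int N..int N}. theta_term v k) \<longlonglongrightarrow> theta_sum v"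
  using tendsto_uniform_limitI[OF theta_sum_uniform_limit[of "norm v"], of v] by simp

lemma theta_pair_sums: "theta_pair v sums (theta_sum v - theta_term v 0)"
  using tendsto_diff[OF theta_sum_LIMSEQ[of v] tendsto_const[of "theta_term v 0"]]
  unfolding theta_sum_partial sums_def by simp

lemma theta_sum_holomorphic: "theta_sum holomorphic_on UNIV"
proof (rule holomorphic_uniform_sequence[OF open_UNIV, of "\<lambda>N v. \<Sum>k\<in>{-int N..int N}. theta_term v k"])
  show "(\<lambda>v. \<Sum>k\<in>{-int N..int N}. theta_term v k) holomorphic_on UNIV" for N
    unfolding theta_term_def by (intro holomorphic_intros)
  fix x :: complex
  have "cball x 1 \<subseteq> cball 0 (norm x + 1)"
    by (simp add: cball_subset_cball_iff)
  then show "\<exists>d>0. cball x d \<subseteq> UNIV \<and>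
      uniform_limit (cball x d) (\<lambda>N v. \<Sum>k\<in>{-int N..int N}. theta_term v k) theta_sum sequentially"
    using uniform_limit_on_subset[OF theta_sum_uniform_limit] by (intro exI[of _ 1]) auto
qed

text \<open>Shifting v by a period moves the summation window by one index, so the symmetric partial
  sums differ by two end terms only, and these tend to 0.\<close>

lemma theta_sum_periodic: "theta_sum (v + 2 * of_real pi) = theta_sum v"
proof -
  have shift: "theta_term (v + 2 * of_real pi) k = theta_term v (k + 1)" for k
    by (simp add: theta_term_def algebra_simps)
  obtain K where K: "\<And>k. norm (theta_term v k) \<le> K * exp (- 1) ^ nat \<bar>k\<bar>"
    using theta_term_bound[of "norm v"] by (metis order_refl)
  have lim0: "(\<lambda>N. K * exp (- 1) ^ N) \<longlonglongrightarrow> 0"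
    using tendsto_mult[OF tendsto_const[of K] LIMSEQ_power_zero[of "exp (- 1) :: real"]] by simp
  have "(\<lambda>N. theta_term v (int N + 1)) \<longlonglongrightarrow> 0"
  proof (rule Lim_null_comparison[OF always_eventually])
    show "\<forall>N. norm (theta_term v (int N + 1)) \<le> K * exp (- 1) ^ Suc N"
      using K[of "int N + 1" for N] by (auto simp: nat_add_distrib)
    show "(\<lambda>N. K * exp (- 1) ^ Suc N) \<longlonglongrightarrow> 0" by (rule LIMSEQ_Suc[OF lim0])
  qed
  moreover have "(\<lambda>N. theta_term v (- int N)) \<longlonglongrightarrow> 0"
    by (rule Lim_null_comparison[OF always_eventually lim0]) (use K[of "- int N" for N] in auto)
  ultimately have "(\<lambda>N. theta_term v (int N + 1) - theta_term v (- int N)) \<longlonglongrightarrow> 0"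
    using tendsto_diff by fastforce
  moreover have "theta_term v (int N + 1) - theta_term v (- int N) =
    (\<Sum>k\<in>{-int N..int N}. theta_term (v + 2 * of_real pi) k) - (\<Sum>k\<in>{-int N..int N}. theta_term v k)" for N
    unfolding shift by (simp add: sum_int_telescope flip: sum_subtractf)
  ultimately have "(\<lambda>N. (\<Sum>k\<in>{-int N..int N}. theta_term (v + 2 * of_real pi) k) - (\<Sum>k\<in>{-int N..int N}. theta_term v k)) \<longlonglongrightarrow> 0"
    by simp
  with tendsto_diff[OF theta_sum_LIMSEQ theta_sum_LIMSEQ] have "theta_sum (v + 2 * of_real pi) - theta_sum v = 0"
    by (rule LIMSEQ_unique)
  then show ?thesis by simp
qed

text \<open>The shift is tuned by 4 c A = 1: the cross term with k in the expanded square is then -2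
  pi i m k and disappears under the exponential, and the remaining factor does not depend on
  k.\<close>

lemma theta_sum_quasiperiodic:
  fixes m :: int
  defines "A \<equiv> 1 / (4 * c)"
  shows "theta_sum (v + 2 * \<i> * A * of_int m) = exp (A * of_int m ^ 2) * (theta_sum v * exp (- (\<i> * of_int m * v)))"
proof -
  have c0: "c \<noteq> 0" using c by auto
  have factor: "theta_term (v + 2 * \<i> * A * of_int m) k = exp (A * of_int m ^ 2) * exp (- (\<i> * of_int m * v)) * theta_term v k" for k
  proof -
    have "- c * (v + 2 * \<i> * A * of_int m + 2 * of_real pi * of_int k)\<^sup>2 =
      A * of_int m ^ 2 + - (\<i> * of_int m * v) + - c * (v + 2 * of_real pi * of_int k)\<^sup>2
      + 2 * of_int (- m * k) * of_real pi * \<i>"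
      using c0 by (simp add: A_def power2_eq_square field_simps)
    moreover have "exp (2 * of_int (- m * k) * of_real pi * \<i>) = 1"
      using exp_integer_2pi[of "of_int (- m * k)"] by (simp add: mult_ac)
    ultimately show ?thesis by (simp only: theta_term_def exp_add mult_1_right)
  qed
  have "(\<lambda>N. exp (A * of_int m ^ 2) * exp (- (\<i> * of_int m * v)) * (\<Sum>k\<in>{-int N..int N}. theta_term v k))
    \<longlonglongrightarrow> exp (A * of_int m ^ 2) * exp (- (\<i> * of_int m * v)) * theta_sum v"
    by (intro tendsto_intros theta_sum_LIMSEQ)
  moreover have "(\<lambda>N. exp (A * of_int m ^ 2) * exp (- (\<i> * of_int m * v)) * (\<Sum>k\<in>{-int N..int N}. theta_term v k))
    \<longlonglongrightarrow> theta_sum (v + 2 * \<i> * A * of_int m)"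
    using theta_sum_LIMSEQ[of "v + 2 * \<i> * A * of_int m"] unfolding factor by (simp add: sum_distrib_left)
  ultimately show ?thesis
    using LIMSEQ_unique by (fastforce simp: mult_ac)
qed

text \<open>Shifting the contour by \<open>2 \<i> A m\<close> with \<open>A = 1 / (4 c)\<close> expresses every Fourier coefficient
  through the zeroth one, so only a single Gaussian integral has to be evaluated.\<close>

lemma theta_sum_fourier_coefficient:
  "integral {-pi..pi} (\<lambda>v. theta_sum (of_real v) * exp (- (\<i> * of_int m * of_real v))) =
   exp (- (of_int m)\<^sup>2 / (4 * c)) * integral {-pi..pi} (\<lambda>v. theta_sum (of_real v))"
proof -
  have "integral {-pi..pi} (\<lambda>v. theta_sum (of_real v)) =
     exp (1 / (4 * c) * (of_int m)\<^sup>2) *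
       integral {-pi..pi} (\<lambda>v. theta_sum (of_real v) * exp (- (\<i> * of_int m * of_real v)))"
    using integral_periodic_shift[OF theta_sum_holomorphic theta_sum_periodic, of "2 * \<i> * (1 / (4 * c)) * of_int m"]
    unfolding theta_sum_quasiperiodic by simp
  then show ?thesis by (simp add: exp_minus)
qed

lemma gaussian_integral_halfline:
  "has_bochner_integral halfline (\<lambda>v. exp (- c * (of_real v)\<^sup>2)) (of_real (sqrt pi) / 2 * c powr (- (1 / 2)))"
proof -
  let ?f = "\<lambda>t::real. of_real t powr (1 / 2 - 1) * exp (- c * of_real t)"
  have f: "has_bochner_integral halfline ?f (of_real (sqrt pi) * c powr (- (1 / 2)))"
    using Gamma_integral_halfline_complex[of "1 / 2" c] c by (simp add: Gamma_one_half_complex)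
  have "x \<in> (\<lambda>v. v\<^sup>2) ` {0<..}" if "x > 0" for x :: real
    using that by (intro image_eqI[of _ _ "sqrt x"]) auto
  then have img: "(\<lambda>v. v\<^sup>2) ` {0<..} = {0::real<..}" by auto
  have inj: "inj_on (\<lambda>v. v\<^sup>2) {0::real<..}" by (auto simp: inj_on_def power2_eq_iff_nonneg)
  have der: "((\<lambda>v. v\<^sup>2) has_field_derivative 2 * x) (at x)" for x :: real
    by (auto intro!: derivative_eq_intros)
  have m: "?f \<in> borel_measurable borel" "(\<lambda>v::real. v\<^sup>2) \<in> borel_measurable borel"
    "(\<lambda>v::real. 2 * v) \<in> borel_measurable borel" by measurable
  have "has_bochner_integral halfline (\<lambda>v. \<bar>2 * v\<bar> *\<^sub>R ?f (v\<^sup>2)) (of_real (sqrt pi) * c powr (- (1 / 2)))"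
    using f integrable_change_of_variables[OF m _ _ img inj der] integral_change_of_variables[OF m _ _ img inj der]
    unfolding has_bochner_integral_iff by simp
  then have "has_bochner_integral halfline (\<lambda>v. 1 / 2 * (\<bar>2 * v\<bar> *\<^sub>R ?f (v\<^sup>2))) (1 / 2 * (of_real (sqrt pi) * c powr (- (1 / 2))))"
    by (rule has_bochner_integral_mult_right)
  then show ?thesis
  proof (rule has_bochner_integral_eqI)
    fix v assume "v \<in> space halfline"
    then have v: "v > 0" by (simp add: space_restrict_space)
    have "complex_of_real (v\<^sup>2) powr (1 / 2 - 1) = of_real ((v powr 2) powr (- 1 / 2))"
      using v by (subst powr_of_real[symmetric]) auto
    also have "(v powr 2) powr (- 1 / 2) = 1 / v"
      using v by (simp only: powr_powr) (simp add: powr_minus field_simps)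
    finally show "exp (- c * (of_real v)\<^sup>2) = 1 / 2 * (\<bar>2 * v\<bar> *\<^sub>R ?f (v\<^sup>2))"
      using v by (simp add: scaleR_conv_of_real)
  qed simp
qed

text \<open>The translates of one period tile the line, so integrating a symmetric partial sum over
  the period gives the Gaussian integral from -(2N+1) pi to (2N+1) pi.\<close>

lemma theta_sum_integral:
  "integral {-pi..pi} (\<lambda>v. theta_sum (of_real v)) = of_real (sqrt pi) * c powr (- (1 / 2))"
proof -
  let ?g = "\<lambda>v. exp (- c * (of_real v)\<^sup>2)"
  define X where "X = (\<lambda>N. pi + 2 * pi * real N)"
  have X0: "X N \<ge> 0" for N by (simp add: X_def)
  have int: "?g integrable_on {a..b}" for a b
    by (intro integrable_continuous_interval continuous_intros)
  have intt: "(\<lambda>v. theta_term (of_real v) k) integrable_on {a..b}" for a b k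
    unfolding theta_term_def by (intro integrable_continuous_interval continuous_intros)
  have shift: "integral {-pi..pi} (\<lambda>v. theta_term (of_real v) k) = integral {-pi + 2 * pi * of_int k..pi + 2 * pi * of_int k} ?g" for k
    using integral_shift_real_ivl[of "-pi + 2 * pi * of_int k" "2 * pi * of_int k" "pi + 2 * pi * of_int k" ?g]
    by (simp add: theta_term_def)
  have "integral {-pi..pi} (\<lambda>v. \<Sum>k\<in>{-int N..int N}. theta_term (of_real v) k) = integral {- X N..X N} ?g" for N
  proof -
    have "integral {-pi..pi} (\<lambda>v. \<Sum>k\<in>{-int N..int N}. theta_term (of_real v) k) =
      (\<Sum>k\<in>{-int N..int N}. integral {-pi + 2 * pi * of_int k..pi + 2 * pi * of_int k} ?g)"
      by (subst integral_sum) (auto intro: intt simp: shift)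
    also have "\<dots> = integral {- X N..X N} ?g"
      unfolding sum_symmetric_int_interval
    proof (induction N)
      case (Suc N)
      have comb: "integral {a..b} ?g = integral {a..m} ?g + integral {m..b} ?g" if "a \<le> m" "m \<le> b" for a b m
        using Henstock_Kurzweil_Integration.integral_combine[OF that int] by simp
      have "X N \<le> X (Suc N)" by (simp add: X_def)
      then have "integral {- X (Suc N)..X (Suc N)} ?g =
         integral {- X (Suc N)..- X N} ?g + (integral {- X N..X N} ?g + integral {X N..X (Suc N)} ?g)"
        using X0[of N] comb[of "- X (Suc N)" "- X N" "X (Suc N)"] comb[of "- X N" "X N" "X (Suc N)"] by simp
      moreover have "{X N..X (Suc N)} = {-pi + 2 * pi * of_int (int (Suc N))..pi + 2 * pi * of_int (int (Suc N))}"
        "{- X (Suc N)..- X N} = {-pi + 2 * pi * of_int (- int (Suc N))..pi + 2 * pi * of_int (- int (Suc N))}"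
        by (simp_all add: X_def algebra_simps)
      ultimately show ?case using Suc by (simp add: algebra_simps)
    qed (simp add: X_def)
    finally show ?thesis .
  qed
  moreover have "integral {- X N..X N} ?g = 2 * integral {0..X N} ?g" for N
  proof -
    have "integral {- X N..0} ?g = integral {0..X N} ?g"
      using Henstock_Kurzweil_Integration.integral_reflect_real[of "X N" 0 ?g] by simp
    then show ?thesis
      using Henstock_Kurzweil_Integration.integral_combine[of "- X N" 0 "X N" ?g] X0[of N] int by simp
  qed
  moreover have "(\<lambda>N. integral {0..X N} ?g) \<longlonglongrightarrow> of_real (sqrt pi) / 2 * c powr (- (1 / 2))"
  proof -
    have g: "integrable halfline ?g" "integral\<^sup>L halfline ?g = of_real (sqrt pi) / 2 * c powr (- (1 / 2))"
      using gaussian_integral_halfline by (auto simp: has_bochner_integral_iff)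
    have "(\<lambda>N. integral\<^sup>L halfline (\<lambda>v. indicator {..X N} v *\<^sub>R ?g v)) \<longlonglongrightarrow> integral\<^sup>L halfline ?g"
    proof (rule integral_dominated_convergence[where w = "\<lambda>v. norm (?g v)"])
      show "AE v in halfline. (\<lambda>N. indicator {..X N} v *\<^sub>R ?g v) \<longlonglongrightarrow> ?g v"
      proof (rule AE_I2, rule tendsto_eventually)
        fix v :: real
        have "filterlim X at_top sequentially" unfolding X_def by real_asymp
        then have "\<forall>\<^sub>F N in sequentially. v \<le> X N" by (simp add: filterlim_at_top)
        then show "\<forall>\<^sub>F N in sequentially. indicator {..X N} v *\<^sub>R ?g v = ?g v"
          by eventually_elim auto
      qed
      show "integrable halfline (\<lambda>v. norm (?g v))" by (rule integrable_norm[OF g(1)])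
    qed (use g in \<open>auto split: split_indicator\<close>)
    moreover have "integral\<^sup>L halfline (\<lambda>v. indicator {..X N} v *\<^sub>R ?g v) = integral {0..X N} ?g" for N
    proof -
      have m: "(\<lambda>v. indicator {..X N} v *\<^sub>R ?g v) \<in> borel_measurable borel" by measurable
      have "integrable halfline (\<lambda>v. indicator {..X N} v *\<^sub>R ?g v)"
        by (rule Bochner_Integration.integrable_bound[OF g(1)]) (auto split: split_indicator)
      then have "integral\<^sup>L halfline (\<lambda>v. indicator {..X N} v *\<^sub>R ?g v) = integral {0<..} (\<lambda>v. indicator {..X N} v *\<^sub>R ?g v)"
        using integral_restrict_lborel_eq[OF m, of "{0<..}"] by simp
      also have "\<dots> = integral {0<..} (\<lambda>v. if v \<in> {0..X N} then ?g v else 0)"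
        by (rule Henstock_Kurzweil_Integration.integral_cong) auto
      also have "\<dots> = integral ({0<..} \<inter> {0..X N}) ?g"
        by (subst integral_restrict_Int) (simp add: Int_commute)
      also have "\<dots> = integral {0..X N} ?g"
        by (rule integral_subset_negligible) (auto intro: negligible_subset[of "{0}"])
      finally show ?thesis .
    qed
    ultimately show ?thesis unfolding g(2) by (simp only:)
  qed
  ultimately have "(\<lambda>N. integral {-pi..pi} (\<lambda>v. \<Sum>k\<in>{-int N..int N}. theta_term (of_real v) k)) \<longlonglongrightarrow>
      2 * (of_real (sqrt pi) / 2 * c powr (- (1 / 2)))"
    by (simp only:) (rule tendsto_mult_left)
  moreover have "(\<lambda>N. integral {-pi..pi} (\<lambda>v. \<Sum>k\<in>{-int N..int N}. theta_term (of_real v) k)) \<longlonglongrightarrow>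
      integral {-pi..pi} (\<lambda>v. theta_sum (of_real v))"
  proof -
    have ul: "uniform_limit {-pi..pi} (\<lambda>N v. \<Sum>k\<in>{-int N..int N}. theta_term (of_real v) k) (\<lambda>v. theta_sum (of_real v)) sequentially"
      by (rule uniform_limit_compose'[OF theta_sum_uniform_limit[of pi]]) auto
    have "continuous_on {-pi..pi} (\<lambda>v. \<Sum>k\<in>{-int N..int N}. theta_term (of_real v) k)" for N
      unfolding theta_term_def by (intro continuous_intros)
    then obtain I J where IJ: "\<And>N. ((\<lambda>v. \<Sum>k\<in>{-int N..int N}. theta_term (of_real v) k) has_integral I N) {-pi..pi}"
      "((\<lambda>v. theta_sum (of_real v)) has_integral J) {-pi..pi}" "I \<longlonglongrightarrow> J"
      by (rule uniform_limit_integral[OF ul _ sequentially_bot]) blast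
    have "I = (\<lambda>N. integral {-pi..pi} (\<lambda>v. \<Sum>k\<in>{-int N..int N}. theta_term (of_real v) k))"
      by (intro ext integral_unique[symmetric] IJ)
    with IJ show ?thesis by (simp only: integral_unique[OF IJ(2)])
  qed
  ultimately show ?thesis using LIMSEQ_unique by fastforce
qed

text \<open>Opposite frequencies combine to cosines, and division by the zeroth coefficient sqrt pi
  c^(-1/2) normalises the constant term to 1.\<close>

lemma theta_sum_conv_fourier:
  "(\<lambda>n. exp (- (of_nat (Suc n))\<^sup>2 / (4 * c)) * cos (of_nat (Suc n) * z)) sums
     ((of_real (sqrt pi) * c powr (1 / 2) * theta_sum z * 2 - 1) / 2)"
proof -
  define a0 where "a0 = of_real (sqrt pi) * c powr (- (1 / 2))"
  have c0: "c \<noteq> 0" using c by auto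
  have a0: "a0 \<noteq> 0" using c0 by (simp add: a0_def)
  have a0': "2 * of_real pi * theta_sum z / a0 = of_real (sqrt pi) * c powr (1 / 2) * theta_sum z * 2"
  proof -
    have P: "c powr (1 / 2) \<noteq> 0" using c0 by simp
    have sp: "complex_of_real (sqrt pi) * of_real (sqrt pi) = of_real pi"
      by (simp flip: of_real_mult)
    have alg: "2 * (s * s) * t / (s * inverse p) = s * p * t * 2" if "s \<noteq> 0" "p \<noteq> 0" for s t p :: complex
      using that by (simp add: field_simps)
    have "2 * (of_real (sqrt pi) * of_real (sqrt pi)) * theta_sum z / (of_real (sqrt pi) * inverse (c powr (1 / 2))) =
      of_real (sqrt pi) * c powr (1 / 2) * theta_sum z * 2"
      by (rule alg) (use P in auto)
    then show ?thesis unfolding a0_def powr_minus sp .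
  qed
  let ?t = "\<lambda>n. exp (- (of_nat (Suc n))\<^sup>2 / (4 * c)) * cos (of_nat (Suc n) * z)"
  have "(\<Sum>m\<in>{-int N..int N}. exp (\<i> * of_int m * z) * (exp (- (of_int m)\<^sup>2 / (4 * c)) * a0))
     = a0 * (1 + 2 * (\<Sum>n<N. ?t n))" for N
  proof -
    have pair: "exp (\<i> * of_int (int (Suc n)) * z) * (exp (- (of_int (int (Suc n)))\<^sup>2 / (4 * c)) * a0) +
          exp (\<i> * of_int (- int (Suc n)) * z) * (exp (- (of_int (- int (Suc n)))\<^sup>2 / (4 * c)) * a0)
         = a0 * (2 * ?t n)" for n
    proof -
      have "(of_int (- int (Suc n)) :: complex)\<^sup>2 = (of_nat (Suc n))\<^sup>2"
        by (simp del: of_nat_Suc)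
      moreover have "\<i> * of_int (- int (Suc n)) * z = - (\<i> * (of_nat (Suc n) * z))"
        by (simp del: of_nat_Suc)
      ultimately show ?thesis
        unfolding cos_exp_eq by (simp add: field_simps del: of_nat_Suc)
    qed
    show ?thesis
      unfolding sum_symmetric_int_interval pair by (simp add: ring_distribs sum_distrib_left)
  qed
  then have "(\<lambda>N. a0 * (1 + 2 * (\<Sum>n<N. ?t n))) \<longlonglongrightarrow> 2 * of_real pi * theta_sum z"
    using fourier_series_symmetric[OF theta_sum_holomorphic theta_sum_periodic, of z]
    unfolding theta_sum_fourier_coefficient theta_sum_integral a0_def[symmetric] by simp
  from tendsto_divide[OF tendsto_diff[OF tendsto_divide[OF this tendsto_const[of a0] a0] tendsto_const[of 1]] tendsto_const[of 2]]
  have "(\<lambda>N. \<Sum>n<N. ?t n) \<longlonglongrightarrow> (2 * of_real pi * theta_sum z / a0 - 1) / 2"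
    using a0 by simp
  then show ?thesis unfolding sums_def a0' .
qed

end

text \<open>One function is expanded in two ways. With c = 1/(4 A) the Fourier factors exp(-m^2/(4
  c)) are exp(-m^2 A), while the translates of the Gaussian, paired as k and -k, give the hyperbolic
  cosines.\<close>

lemma theta_transformation:
  fixes A B :: complex
  assumes A: "Re A > 0"
  shows "summable (\<lambda>n. exp (- (of_nat (Suc n))\<^sup>2 * A) * cos (of_nat (Suc n) * B))"
    and "summable (\<lambda>n. exp (- (of_nat (Suc n) * of_real pi)\<^sup>2 / A) * cosh (of_nat (Suc n) * of_real pi * B / A))"
    and "1 + 2 * (\<Sum>n. exp (- (of_nat (Suc n))\<^sup>2 * A) * cos (of_nat (Suc n) * B)) =
      of_real (sqrt pi) * A powr (- (1 / 2)) * exp (- B\<^sup>2 / (4 * A)) *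
      (1 + 2 * (\<Sum>n. exp (- (of_nat (Suc n) * of_real pi)\<^sup>2 / A) * cosh (of_nat (Suc n) * of_real pi * B / A)))"
proof -
  define c where "c = 1 / (4 * A)"
  have A0: "A \<noteq> 0" using A by auto
  have c: "Re c > 0"
    unfolding c_def Re_divide using A by (intro divide_pos_pos add_pos_nonneg) auto
  have "- (of_nat (Suc n))\<^sup>2 / (4 * c) = - (of_nat (Suc n))\<^sup>2 * A" for n
    using A0 by (simp add: c_def)
  then have s1: "(\<lambda>n. exp (- (of_nat (Suc n))\<^sup>2 * A) * cos (of_nat (Suc n) * B)) sums
     ((of_real (sqrt pi) * c powr (1 / 2) * theta_sum c B * 2 - 1) / 2)"
    using theta_sum_conv_fourier[OF c, of B] by simp
  let ?h = "\<lambda>n. exp (- (of_nat (Suc n) * of_real pi)\<^sup>2 / A) * cosh (of_nat (Suc n) * of_real pi * B / A)"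
  have pair: "theta_pair c B = (\<lambda>n. 2 * exp (- c * B\<^sup>2) * ?h n)"
  proof
    fix n
    have "- c * (B + 2 * of_real pi * of_nat (Suc n))\<^sup>2 = - c * B\<^sup>2 + (- (of_nat (Suc n) * of_real pi)\<^sup>2 / A) + - (of_nat (Suc n) * of_real pi * B / A)"
      "- c * (B - 2 * of_real pi * of_nat (Suc n))\<^sup>2 = - c * B\<^sup>2 + (- (of_nat (Suc n) * of_real pi)\<^sup>2 / A) + of_nat (Suc n) * of_real pi * B / A"
      using A0 by (simp_all add: c_def power2_eq_square divide_simps) (simp_all add: algebra_simps)
    then have e: "exp (- c * (B + 2 * of_real pi * of_nat (Suc n))\<^sup>2) = exp (- c * B\<^sup>2) * exp (- (of_nat (Suc n) * of_real pi)\<^sup>2 / A) * exp (- (of_nat (Suc n) * of_real pi * B / A))"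
       "exp (- c * (B - 2 * of_real pi * of_nat (Suc n))\<^sup>2) = exp (- c * B\<^sup>2) * exp (- (of_nat (Suc n) * of_real pi)\<^sup>2 / A) * exp (of_nat (Suc n) * of_real pi * B / A)"
      by (simp_all only: exp_add)
    have "theta_pair c B n = exp (- c * (B + 2 * of_real pi * of_nat (Suc n))\<^sup>2) + exp (- c * (B - 2 * of_real pi * of_nat (Suc n))\<^sup>2)"
      by (simp add: theta_pair_def[OF c] theta_term_def[OF c] algebra_simps)
    also have "\<dots> = exp (- c * B\<^sup>2) * exp (- (of_nat (Suc n) * of_real pi)\<^sup>2 / A) * (2 * cosh (of_nat (Suc n) * of_real pi * B / A))"
      unfolding e cosh_field_def by (simp add: ring_distribs)
    finally show "theta_pair c B n = 2 * exp (- c * B\<^sup>2) * ?h n" by simp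
  qed
  have "theta_term c B 0 = exp (- c * B\<^sup>2)"
    by (simp add: theta_term_def[OF c])
  then have "(\<lambda>n. 2 * exp (- c * B\<^sup>2) * ?h n) sums (theta_sum c B - exp (- c * B\<^sup>2))"
    using theta_pair_sums[OF c, of B] by (simp only: pair)
  from sums_divide[OF this, of "2 * exp (- c * B\<^sup>2)"]
  have s2: "?h sums ((theta_sum c B / exp (- c * B\<^sup>2) - 1) / 2)"
    by (simp add: diff_divide_distrib mult.commute)
  show "summable (\<lambda>n. exp (- (of_nat (Suc n))\<^sup>2 * A) * cos (of_nat (Suc n) * B))" "summable ?h"
    using s1 s2 by (auto simp: sums_iff)
  have "2 * (c powr (1 / 2)) = A powr (- (1 / 2))"
  proof -
    have "c = of_real (1 / 4) * inverse A" by (simp add: c_def field_simps)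
    then have "c powr (1 / 2) = of_real (1 / 4) powr (1 / 2) * inverse A powr (1 / 2)"
      by (simp only:) (rule powr_of_real_mult, simp)
    also have "of_real (1 / 4) powr (1 / 2) = (1 / 2 :: complex)"
    proof -
      have "complex_of_real (1 / 4) powr of_real (1 / 2) = of_real ((1 / 4) powr (1 / 2))"
        by (rule powr_of_real) auto
      also have "(1 / 4) powr (1 / 2 :: real) = 1 / 2"
        by (simp add: powr_half_sqrt real_sqrt_divide)
      finally show ?thesis by simp
    qed
    also have "inverse A powr (1 / 2) = A powr (- (1 / 2))"
      using A A0 by (simp add: powr_def Ln_inverse complex_nonpos_Reals_iff)
    finally show ?thesis by (simp add: mult.commute)
  qed
  then have "1 + 2 * suminf (\<lambda>n. exp (- (of_nat (Suc n))\<^sup>2 * A) * cos (of_nat (Suc n) * B)) =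
      of_real (sqrt pi) * A powr (- (1 / 2)) * theta_sum c B"
  proof -
    assume P: "2 * (c powr (1 / 2)) = A powr (- (1 / 2))"
    show ?thesis unfolding sums_unique[OF s1, symmetric] P[symmetric] by (simp add: field_simps)
  qed
  also have "theta_sum c B = exp (- B\<^sup>2 / (4 * A)) * (1 + 2 * suminf ?h)"
    unfolding sums_unique[OF s2, symmetric] by (simp add: c_def field_simps)
  finally show "1 + 2 * (\<Sum>n. exp (- (of_nat (Suc n))\<^sup>2 * A) * cos (of_nat (Suc n) * B)) =
      of_real (sqrt pi) * A powr (- (1 / 2)) * exp (- B\<^sup>2 / (4 * A)) * (1 + 2 * suminf ?h)"
    by (simp only: mult.assoc)
qed

section \<open>The summation formula\<close>

text \<open>A majorant in product form meets both needs at once: the sequence \<open>c\<close> gives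
  pointwise convergence of the series, the function \<open>g\<close> an integrable bound for its
  partial sums.\<close>

lemma
  fixes f :: "nat \<Rightarrow> 'a \<Rightarrow> complex"
  assumes f [measurable]: "\<And>n. f n \<in> borel_measurable M" and g: "integrable M g" and c: "summable c"
    and bound: "\<And>n x. x \<in> space M \<Longrightarrow> norm (f n x) \<le> c n * g x"
    and g0: "\<And>x. x \<in> space M \<Longrightarrow> g x \<ge> 0" and c0: "\<And>n. c n \<ge> 0"
  shows integrable_suminf_bounded: "integrable M (\<lambda>x. \<Sum>n. f n x)"
    and integral_sums_bounded: "(\<lambda>n. integral\<^sup>L M (f n)) sums integral\<^sup>L M (\<lambda>x. \<Sum>n. f n x)"
proof -
  have int: "integrable M (f n)" for n
    by (rule Bochner_Integration.integrable_bound[OF integrable_mult_right[OF g, of "c n"]])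
       (use bound g0 c0 in \<open>auto intro!: AE_I2 simp: abs_mult\<close>)
  have G: "integrable M (\<lambda>x. suminf c * g x)" by (rule integrable_mult_right[OF g])
  have sums: "(\<lambda>n. f n x) sums (\<Sum>n. f n x)" if "x \<in> space M" for x
    by (rule summable_sums, rule summable_comparison_test'[where g = "\<lambda>n. c n * g x"])
       (use bound[OF that] c in \<open>auto intro: summable_mult2\<close>)
  have partial: "norm (\<Sum>n<N. f n x) \<le> suminf c * g x" if "x \<in> space M" for N x
  proof -
    have "norm (\<Sum>n<N. f n x) \<le> (\<Sum>n<N. c n * g x)"
      by (rule sum_norm_le) (use bound[OF that] in auto)
    also have "\<dots> = (\<Sum>n<N. c n) * g x" by (simp add: sum_distrib_right)
    also have "\<dots> \<le> suminf c * g x"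
      by (intro mult_right_mono sum_le_suminf c) (use g0[OF that] c0 in auto)
    finally show ?thesis .
  qed
  show "integrable M (\<lambda>x. \<Sum>n. f n x)"
    by (rule integrable_sums_dominated[OF int G sums partial])
  show "(\<lambda>n. integral\<^sup>L M (f n)) sums integral\<^sup>L M (\<lambda>x. \<Sum>n. f n x)"
    by (rule integral_sums_dominated[OF int G sums partial])
qed

lemma norm_cosh_le: "norm (cosh z) \<le> exp (norm z)" for z :: complex
proof -
  have "cosh z = cos (\<i> * z)" by (simp add: cosh_conv_cos)
  then show ?thesis using norm_cos_le[of "\<i> * z"] by (simp add: norm_mult)
qed

text \<open>Gaussian decay in m is exchanged for m^(-\<beta>) with \<beta> at choice. In the
  applications m is n/sqrt t or n sqrt t, so that the bound splits into a power of n and a power of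
  t, which the exponential does not do.\<close>

lemma norm_exp_mult_le_powr:
  assumes \<rho>: "Re \<rho> > 0" and \<beta>: "\<beta> \<ge> 0" and m: "m > 0" and q: "norm q \<le> exp (\<kappa> * m)"
  shows "norm (exp (- (\<rho> * of_real (m\<^sup>2))) * q) \<le> exp ((\<kappa> + \<beta>)\<^sup>2 / (4 * Re \<rho>)) * m powr (- \<beta>)"
proof -
  have "norm (exp (- (\<rho> * of_real (m\<^sup>2))) * q) \<le> exp (- Re \<rho> * m\<^sup>2) * exp (\<kappa> * m)"
    unfolding norm_mult using q by (intro mult_mono) auto
  also have "\<dots> = exp (- Re \<rho> * m\<^sup>2 + \<kappa> * m)" by (simp only: exp_add)
  also have "\<dots> \<le> exp ((\<kappa> + \<beta>)\<^sup>2 / (4 * Re \<rho>)) * m powr (- \<beta>)"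
    using powr_mult_quadratic_exp_le[OF \<rho> \<beta> m, of \<kappa>] m by (simp add: powr_minus field_simps)
  finally show ?thesis .
qed

lemma mellin_exp_cos_of_real:
  assumes "Re a > 0"
  shows "has_bochner_integral halfline (\<lambda>t. of_real t powr (a - 1) * exp_cos w (of_real t)) (hyp_gamma w a)"
  using mellin_exp_cos[of a 1 w] assms by simp

lemma cos_mult_cosh: "cos a * cosh b = (cos (a + \<i> * b) + cos (a - \<i> * b)) / 2" for a b :: complex
  by (simp add: cos_add cos_diff cosh_conv_cos)

section \<open>The individual terms of the two series\<close>

context
  fixes x :: complex
  assumes x: "x \<noteq> 0" "\<bar>Arg x\<bar> < pi / 4"
begin

lemma Re_sq_pos: "Re (x\<^sup>2) > 0"
  using Re_sq_div_pos[OF x, of 1] by simp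

lemma Re_inverse_sq_pos: "Re (1 / x\<^sup>2) > 0"
  unfolding Re_divide using Re_sq_pos by (intro divide_pos_pos add_pos_nonneg) auto

text \<open>The root n x/(2 sqrt t) is the principal one since Re x > 0. Inside the cosine n thus
  enters linearly, as in the theta series.\<close>

lemma exp_cos_of_nat_mult_sq:
  assumes t: "t > 0" and n: "n > 0"
  shows "exp_cos w ((of_nat n * x)\<^sup>2 / of_real (4 * t)) =
     exp (- (of_nat n)\<^sup>2 * (x\<^sup>2 / of_real (4 * t))) * cos (of_nat n * (w * x / of_real (2 * sqrt t)))"
proof -
  have "csqrt ((of_nat n * x)\<^sup>2 / of_real (4 * t)) = of_nat n * x / of_real (2 * sqrt t)"
  proof (rule csqrt_unique)
    show "(of_nat n * x / of_real (2 * sqrt t))\<^sup>2 = (of_nat n * x)\<^sup>2 / of_real (4 * t)"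
      using t by (simp add: power_divide power_mult_distrib flip: of_real_power)
    have "Re (of_nat n * x / of_real (2 * sqrt t)) = real n * Re x / (2 * sqrt t)"
      by (simp add: Re_divide_of_real del: of_real_mult)
    also have "\<dots> > 0" using t n Re_pos_of_Arg_less[OF x] by simp
    finally show "0 < Re (of_nat n * x / of_real (2 * sqrt t)) \<or>
      Re (of_nat n * x / of_real (2 * sqrt t)) = 0 \<and> 0 \<le> Im (of_nat n * x / of_real (2 * sqrt t))" by blast
  qed
  then show ?thesis by (simp add: exp_cos_def power_mult_distrib mult_ac)
qed

text \<open>The factor (n x/2)^z cancels the power (n x/2)^(-z) in the half-line formula for the
  Bessel function, so that n survives only in the last factor of the integrand.\<close>

lemma bessel_term_eq:
  assumes n: "n > 0"
  shows "(of_nat n * x / 2) powr z * gen_bessel_K z w (of_nat n * x) =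
    1 / 2 * (CLINT u|halfline. of_real u powr (z - 1) * exp_cos w (of_real u) * exp_cos w ((of_nat n * x)\<^sup>2 / of_real (4 * u)))"
proof -
  have nx: "of_nat n * x \<noteq> 0" "\<bar>Arg (of_nat n * x)\<bar> < pi / 4"
    using x n Arg_times_of_real[of "real n" x] by auto
  have "(of_nat n * x / 2) powr z * (of_nat n * x / 2) powr (- z) = 1"
    using nx by (simp add: powr_minus)
  then show ?thesis
    unfolding gen_bessel_K_eq[OF nx] by (simp add: mult.assoc[symmetric] mult.commute[of "_ powr _" "1 / 2"])
qed

text \<open>The n-th integrand on the transformed side. The square root of t that comes from
  A^(-1/2) is absorbed in the exponent, written as (z + 1/2) - 1 to match a Mellin integral at z +
  1/2; factors independent of both t and n are left out.\<close>

definition dual_term :: "complex \<Rightarrow> complex \<Rightarrow> nat \<Rightarrow> real \<Rightarrow> complex" where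
  "dual_term z w n t = of_real t powr (z + 1 / 2 - 1) * exp_cos w (of_real t) *
     (exp (- (of_nat n * of_real pi)\<^sup>2 / (x\<^sup>2 / of_real (4 * t))) *
      cosh (of_nat n * of_real pi * (w * x / of_real (2 * sqrt t)) / (x\<^sup>2 / of_real (4 * t))))"

lemma dual_term_eq:
  assumes t: "t > 0"
  shows "dual_term z w n t = of_real t powr (z + 1 / 2 - 1) * exp_cos w (of_real t) *
     (exp (- (4 * (of_real pi)\<^sup>2 * (1 / x\<^sup>2) * of_real ((real n * sqrt t)\<^sup>2))) *
      cosh (2 * of_real pi * w / x * of_real (real n * sqrt t)))"
proof -
  have "complex_of_real (sqrt t) * of_real (sqrt t) = of_real t"
    using t by (simp flip: of_real_mult)
  moreover have "complex_of_real (sqrt t) \<noteq> 0" using t by simp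
  ultimately have "of_nat n * of_real pi * (w * x / of_real (2 * sqrt t)) / (x\<^sup>2 / of_real (4 * t)) =
     2 * of_real pi * w / x * of_real (real n * sqrt t)"
    using x t by (simp add: power2_eq_square field_simps)
  moreover have "- (of_nat n * of_real pi)\<^sup>2 / (x\<^sup>2 / of_real (4 * t)) =
      - (4 * (of_real pi)\<^sup>2 * (1 / x\<^sup>2) * of_real ((real n * sqrt t)\<^sup>2))"
    using x t by (simp add: power_mult_distrib field_simps)
  ultimately show ?thesis by (simp only: dual_term_def)
qed

text \<open>Numerator and denominator both have argument below pi/2 in modulus, so the difference of
  their logarithms is still the principal logarithm of the quotient.\<close>

lemma powr_one_plus_sq_div:
  assumes "N > 0"
  shows "((x\<^sup>2 + of_real N) / x\<^sup>2) powr (- b) = x powr (2 * b) / (x\<^sup>2 + of_real N) powr b"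
proof -
  let ?X = "x\<^sup>2 + of_real N"
  have ReX: "Re ?X > 0" using Re_sq_pos assms by simp
  then have X0: "?X \<noteq> 0" by (metis less_irrefl zero_complex.sel(1))
  have L: "Ln (x\<^sup>2) = 2 * Ln x" using Ln_sq_div[OF x, of 1] by simp
  have "Ln (?X / x\<^sup>2) = Ln ?X - 2 * Ln x"
  proof (rule Ln_unique)
    show "exp (Ln ?X - 2 * Ln x) = ?X / x\<^sup>2"
      using x X0 by (simp add: exp_diff exp_double)
    have "\<bar>Im (Ln ?X)\<bar> < pi / 2" using ReX X0 Arg_Re_pos[of ?X] by (simp add: Arg_eq_Im_Ln)
    moreover have "\<bar>Im (2 * Ln x)\<bar> < pi / 2" using x by (simp add: Arg_eq_Im_Ln)
    ultimately show "- pi < Im (Ln ?X - 2 * Ln x)" "Im (Ln ?X - 2 * Ln x) \<le> pi" by auto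
  qed
  moreover have "exp (- b * (Ln ?X - 2 * Ln x)) = exp (2 * b * Ln x) / exp (b * Ln ?X)"
    by (simp add: algebra_simps flip: exp_diff)
  ultimately show ?thesis
    using x X0 by (simp add: powr_def)
qed

text \<open>The product of cosine and hyperbolic cosine is the mean of two cosines with frequencies
  w (1 + i k/x) and w (1 - i k/x), k = 2 pi n, and the total rate is p = 1 + k^2/x^2. The
  factorisation x^2 + k^2 = (x + i k)(x - i k) then produces the two arguments in
  \<open>calA\<close>.\<close>

lemma dual_term_integral:
  assumes z: "Re z > 0" and n: "n > 0"
  shows "has_bochner_integral halfline (dual_term z w n)
    (1 / 2 * Gamma (1 / 2 + z) * x powr (2 * z + 1) *
      (calA n z w x / (x\<^sup>2 + 4 * (of_nat n)\<^sup>2 * (of_real pi)\<^sup>2) powr (z + 1 / 2)))"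
proof -
  define b where "b = z + 1 / 2"
  define k where "k = 2 * complex_of_real pi * of_nat n"
  define X where "X = x\<^sup>2 + of_real ((2 * pi * real n)\<^sup>2)"
  define p where "p = X / x\<^sup>2"
  have b: "Re b > 0" using z by (simp add: b_def)
  have k2: "of_real ((2 * pi * real n)\<^sup>2) = k\<^sup>2" by (simp add: k_def)
  have kn: "(2 * pi * real n)\<^sup>2 > 0" using n by simp
  have ReX: "Re X > 0" unfolding X_def plus_complex.sel Re_complex_of_real using Re_sq_pos kn by (rule add_pos_pos)
  then have X0: "X \<noteq> 0" by (metis less_irrefl zero_complex.sel(1))
  have X: "X = (x + \<i> * k) * (x - \<i> * k)" unfolding X_def k2 by (simp add: power2_eq_square algebra_simps)
  have nz: "x + \<i> * k \<noteq> 0" "x - \<i> * k \<noteq> 0" using X0 unfolding X by auto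
  have p_eq: "p = 1 + k\<^sup>2 * (1 / x\<^sup>2)" unfolding p_def X_def k2 using x by (simp add: field_simps)
  have "Re (of_real r * y) = r * Re y" for r y by simp
  then have "Re p = 1 + (2 * pi * real n)\<^sup>2 * Re (1 / x\<^sup>2)"
    unfolding p_eq k2[symmetric] by (simp only: plus_complex.sel one_complex.sel)
  moreover have "(2 * pi * real n)\<^sup>2 * Re (1 / x\<^sup>2) > 0"
    using kn Re_inverse_sq_pos by (rule mult_pos_pos)
  ultimately have p: "Re p > 0" by linarith
  let ?f = "\<lambda>q t. of_real t powr (b - 1) * exp (- p * of_real t) * cos (q * of_real (sqrt t))"
  let ?J = "\<lambda>q. Gamma b * p powr (- b) * hyp1F1 b (1 / 2) (- (q\<^sup>2 / (4 * p)))"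
  let ?q1 = "w * (1 + \<i> * k / x)" and ?q2 = "w * (1 - \<i> * k / x)"
  have "has_bochner_integral halfline (\<lambda>t. 1 / 2 * (?f ?q1 t + ?f ?q2 t)) (1 / 2 * (?J ?q1 + ?J ?q2))"
    by (intro has_bochner_integral_mult_right has_bochner_integral_add Gamma_cos_integral_halfline b p)
  then show ?thesis
  proof (rule has_bochner_integral_eqI)
    fix t assume "t \<in> space halfline"
    then have t: "t > 0" by (simp add: space_restrict_space)
    have "4 * (of_real pi)\<^sup>2 * (1 / x\<^sup>2) * of_real ((real n * sqrt t)\<^sup>2) = k\<^sup>2 * (1 / x\<^sup>2) * of_real t"
      using t by (simp add: k_def power_mult_distrib)
    moreover have "exp (- of_real t) * exp (- (k\<^sup>2 * (1 / x\<^sup>2) * of_real t)) = exp (- p * of_real t)"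
      by (simp add: p_eq algebra_simps flip: exp_add)
    ultimately have e: "exp (- of_real t) * exp (- (4 * (of_real pi)\<^sup>2 * (1 / x\<^sup>2) * of_real ((real n * sqrt t)\<^sup>2))) = exp (- p * of_real t)"
      by (simp only:)
    have "2 * of_real pi * w / x * of_real (real n * sqrt t) = w * k / x * of_real (sqrt t)"
      by (simp add: k_def)
    moreover have "cos (w * of_real (sqrt t)) * cosh (w * k / x * of_real (sqrt t)) =
       (cos (?q1 * of_real (sqrt t)) + cos (?q2 * of_real (sqrt t))) / 2"
      by (simp add: cos_mult_cosh algebra_simps)
    ultimately have c: "cos (w * of_real (sqrt t)) * cosh (2 * of_real pi * w / x * of_real (real n * sqrt t)) =
       (cos (?q1 * of_real (sqrt t)) + cos (?q2 * of_real (sqrt t))) / 2"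
      by (simp only:)
    have "dual_term z w n t = of_real t powr (b - 1) * (exp (- of_real t) * exp (- (4 * (of_real pi)\<^sup>2 * (1 / x\<^sup>2) * of_real ((real n * sqrt t)\<^sup>2)))) *
       (cos (w * of_real (sqrt t)) * cosh (2 * of_real pi * w / x * of_real (real n * sqrt t)))"
      unfolding dual_term_eq[OF t] b_def exp_cos_def using t by (simp add: csqrt_of_real mult_ac)
    then show "dual_term z w n t = 1 / 2 * (?f ?q1 t + ?f ?q2 t)"
      unfolding e c by (simp only: ring_distribs times_divide_eq_right times_divide_eq_left mult_1 add_divide_distrib)
  next
    have quot: "(w * (P / x))\<^sup>2 / (4 * (P * M / x\<^sup>2)) = w\<^sup>2 * P / (4 * M)" if "P \<noteq> 0" "M \<noteq> 0" for P M
      using that x by (simp add: power2_eq_square field_simps)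
    have q: "1 + \<i> * k / x = (x + \<i> * k) / x" "1 - \<i> * k / x = (x - \<i> * k) / x"
      using x by (simp_all add: field_simps)
    \<comment> \<open>The two linear factors are rewritten as i (k - i x) and -i (k + i x); the
      quotient i/(-i) = -1 supplies the sign that cancels the minus in the argument of
      \<open>hyp1F1\<close>.\<close>
    have rot1: "w\<^sup>2 * (\<i> * P) / (4 * (- \<i> * M)) = - (w\<^sup>2 * P / (4 * M))"
      and rot2: "w\<^sup>2 * (- \<i> * P) / (4 * (\<i> * M)) = - (w\<^sup>2 * P / (4 * M))" for P M
      by (cases "M = 0"; simp add: field_simps)+
    have J1: "- (?q1\<^sup>2 / (4 * p)) = w\<^sup>2 * (2 * of_nat n * of_real pi - \<i> * x) / (8 * of_nat n * of_real pi + 4 * \<i> * x)"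
    proof -
      have "?q1\<^sup>2 / (4 * p) = w\<^sup>2 * (x + \<i> * k) / (4 * (x - \<i> * k))"
        unfolding p_def X q using nz by (rule quot)
      also have "w\<^sup>2 * (x + \<i> * k) / (4 * (x - \<i> * k)) = - (w\<^sup>2 * (k - \<i> * x) / (4 * (k + \<i> * x)))"
      proof -
        have e: "x + \<i> * k = \<i> * (k - \<i> * x)" "x - \<i> * k = - \<i> * (k + \<i> * x)" by (simp_all add: algebra_simps)
        show ?thesis unfolding e by (rule rot1)
      qed
      finally show ?thesis by (simp add: k_def mult_ac ring_distribs)
    qed
    have J2: "- (?q2\<^sup>2 / (4 * p)) = w\<^sup>2 * (2 * of_nat n * of_real pi + \<i> * x) / (8 * of_nat n * of_real pi - 4 * \<i> * x)"
    proof -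
      have "?q2\<^sup>2 / (4 * p) = w\<^sup>2 * (x - \<i> * k) / (4 * (x + \<i> * k))"
        unfolding p_def X q mult.commute[of "x + \<i> * k" "x - \<i> * k"] using nz(2,1) by (rule quot)
      also have "w\<^sup>2 * (x - \<i> * k) / (4 * (x + \<i> * k)) = - (w\<^sup>2 * (k + \<i> * x) / (4 * (k - \<i> * x)))"
      proof -
        have e: "x + \<i> * k = \<i> * (k - \<i> * x)" "x - \<i> * k = - \<i> * (k + \<i> * x)" by (simp_all add: algebra_simps)
        show ?thesis unfolding e by (rule rot2)
      qed
      finally show ?thesis by (simp add: k_def mult_ac ring_distribs)
    qed
    have P: "p powr (- b) = x powr (2 * z + 1) / X powr b"
      using powr_one_plus_sq_div[OF kn, of b] by (simp add: p_def X_def b_def ring_distribs)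
    have X': "x\<^sup>2 + 4 * (of_nat n)\<^sup>2 * (of_real pi)\<^sup>2 = X"
      by (simp add: X_def power_mult_distrib mult_ac)
    have bz: "1 / 2 + z = b" "z + 1 / 2 = b" by (simp_all add: b_def)
    show "1 / 2 * Gamma (1 / 2 + z) * x powr (2 * z + 1) *
      (calA n z w x / (x\<^sup>2 + 4 * (of_nat n)\<^sup>2 * (of_real pi)\<^sup>2) powr (z + 1 / 2)) = 1 / 2 * (?J ?q1 + ?J ?q2)"
      unfolding J1 J2 P X' calA_def bz by (simp add: ring_distribs add_divide_distrib mult_ac)
  qed
qed

end

theorem theorem1p3:
  fixes w z x :: complex
  assumes "Re z > 0"
    and "x \<noteq> 0" and "\<bar>Arg x\<bar> < pi / 4"
  defines "S \<equiv> (\<lambda>n::nat. (of_nat n * x / 2) powr z * gen_bessel_K z w (of_nat n * x))"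
    and "T \<equiv> (\<lambda>n::nat. calA n z w x / (x\<^sup>2 + 4 * (of_nat n)\<^sup>2 * (of_real pi)\<^sup>2) powr (z + 1 / 2))"
  shows "summable (\<lambda>n. S (Suc n)) \<and> summable (\<lambda>n. T (Suc n)) \<and>
    2 * (\<Sum>n. S (Suc n))
      + 1 / 2 * Gamma z * hyp1F1 z (1 / 2) (- (w\<^sup>2 / 4))
      - of_real (sqrt pi) / x * Gamma (1 / 2 + z) * exp (- (w\<^sup>2 / 4))
          * hyp1F1 (1 / 2 + z) (1 / 2) (- (w\<^sup>2 / 4))
    = of_real (sqrt pi) * x powr (2 * z) * Gamma (1 / 2 + z) * exp (- (w\<^sup>2 / 4))
        * (\<Sum>n. T (Suc n))"
proof -
  note x = assms(2,3)
  define \<sigma> where "\<sigma> = Re z"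
  have \<sigma>: "\<sigma> > 0" using assms(1) by (simp add: \<sigma>_def)
  let ?H = "\<lambda>t. exp_cos w (complex_of_real t)"
  define A where "A = (\<lambda>t. x\<^sup>2 / complex_of_real (4 * t))"
  define B where "B = (\<lambda>t. w * x / complex_of_real (2 * sqrt t))"
  define a where "a = (\<lambda>n t. of_real t powr (z - 1) * ?H t * exp_cos w ((of_nat (Suc n) * x)\<^sup>2 / of_real (4 * t)))"
  define b where "b = (\<lambda>n. dual_term x z w (Suc n))"
  have a_eq: "a n t = of_real t powr (z - 1) * ?H t *
      (exp (- (of_nat (Suc n))\<^sup>2 * A t) * cos (of_nat (Suc n) * B t))" if "t > 0" for n t
    unfolding a_def A_def B_def using exp_cos_of_nat_mult_sq[OF x that zero_less_Suc] by simp
  have b_eq: "b n t = of_real t powr (z + 1 / 2 - 1) * ?H t *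
      (exp (- (of_nat (Suc n) * of_real pi)\<^sup>2 / A t) * cosh (of_nat (Suc n) * of_real pi * B t / A t))" for n t
    unfolding b_def A_def B_def by (rule dual_term_def[OF x])

  have Sa: "S (Suc n) = 1 / 2 * integral\<^sup>L halfline (a n)" for n
    unfolding S_def a_def by (rule bessel_term_eq[OF x]) simp
  have am: "a n \<in> borel_measurable halfline" for n
    unfolding a_def by measurable
  have bT: "has_bochner_integral halfline (b n) (1 / 2 * Gamma (1 / 2 + z) * x powr (2 * z + 1) * T (Suc n))" for n
    unfolding b_def T_def by (rule dual_term_integral[OF x assms(1)]) simp
  have bm: "b n \<in> borel_measurable halfline" for n
    using bT[of n] by (auto simp: has_bochner_integral_iff)

  \<comment> \<open>Here m = (n+1)/sqrt t and \<beta> = 2, so m^(-2) = t/(n+1)^2: the sum over n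
    converges and the extra t only improves integrability at 0.\<close>
  obtain Ca where Ca: "Ca \<ge> 0" "\<And>n t. t > 0 \<Longrightarrow> norm (a n t) \<le> Ca * real (Suc n) powr - 2 * norm (of_real t powr (z + 1 - 1) * ?H t)"
  proof
    let ?C = "exp ((norm (w * x / 2) + 2)\<^sup>2 / (4 * Re (x\<^sup>2 / of_real 4)))"
    show "?C \<ge> 0" by simp
    fix n t assume t: "(t::real) > 0"
    define m where "m = real (Suc n) / sqrt t"
    have m: "m > 0" using t by (simp add: m_def)
    have st: "complex_of_real (sqrt t) \<noteq> 0" using t by simp
    have e: "exp (- (of_nat (Suc n))\<^sup>2 * A t) = exp (- (x\<^sup>2 / of_real 4 * of_real (m\<^sup>2)))"
      using t by (simp add: A_def m_def power_divide mult_ac del: of_nat_Suc)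
    have c: "norm (cos (of_nat (Suc n) * B t)) \<le> exp (norm (w * x / 2) * m)"
    proof -
      have eq: "of_nat (Suc n) * B t = (w * x / 2) * of_real m"
        using st by (simp add: B_def m_def del: of_nat_Suc)
      show ?thesis using norm_cos_le[of "(w * x / 2) * of_real m"] m unfolding eq by (simp add: norm_mult)
    qed
    have "norm (exp (- (of_nat (Suc n))\<^sup>2 * A t) * cos (of_nat (Suc n) * B t)) \<le> ?C * m powr - 2"
      unfolding e by (rule norm_exp_mult_le_powr[OF _ _ m c]) (use Re_sq_div_pos[OF x, of 4] in auto)
    also have "sqrt t powr 2 = t" using t by (simp add: powr_half_sqrt[symmetric] powr_powr)
    then have "m powr - 2 = real (Suc n) powr - 2 * t"
      using t by (simp add: m_def powr_divide powr_minus field_simps del: of_nat_Suc powr_numeral)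
    finally have le: "norm (exp (- (of_nat (Suc n))\<^sup>2 * A t) * cos (of_nat (Suc n) * B t)) \<le> ?C * (real (Suc n) powr - 2 * t)" .
    have "norm (a n t) = norm (of_real t powr (z - 1) * ?H t) * norm (exp (- (of_nat (Suc n))\<^sup>2 * A t) * cos (of_nat (Suc n) * B t))"
      unfolding a_eq[OF t] by (rule norm_mult)
    also have "\<dots> \<le> norm (of_real t powr (z - 1) * ?H t) * (?C * (real (Suc n) powr - 2 * t))"
      by (intro mult_left_mono le) auto
    finally have le1: "norm (a n t) \<le> norm (of_real t powr (z - 1) * ?H t) * (?C * (real (Suc n) powr - 2 * t))" .
    have "norm (of_real t powr (z - 1) * ?H t) * t = norm (of_real t powr (z + 1 - 1) * ?H t)"
    proof -
      have "norm (of_real t powr (z - 1)) * t = norm (of_real t powr (z + 1 - 1))"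
        using t unfolding norm_powr_of_real[OF t] by (simp add: powr_diff)
      then show ?thesis unfolding norm_mult by (metis mult.assoc mult.commute)
    qed
    moreover have "norm (of_real t powr (z - 1) * ?H t) * (?C * (real (Suc n) powr - 2 * t)) =
       ?C * real (Suc n) powr - 2 * (norm (of_real t powr (z - 1) * ?H t) * t)"
      by (simp only: mult_ac)
    ultimately have "norm (of_real t powr (z - 1) * ?H t) * (?C * (real (Suc n) powr - 2 * t)) =
       ?C * real (Suc n) powr - 2 * norm (of_real t powr (z + 1 - 1) * ?H t)"
      by (simp only:)
    with le1 show "norm (a n t) \<le> ?C * real (Suc n) powr - 2 * norm (of_real t powr (z + 1 - 1) * ?H t)"
      by (simp only:)
  qed
  \<comment> \<open>Here m = (n+1) sqrt t, so m^(-\<beta>) worsens the singularity at t = 0.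
    Summability needs \<beta> > 1, integrability of t^(\<sigma> + 1/2 - 1 - \<beta>/2) at 0 needs
    \<beta> < 1 + 2 \<sigma>; the midpoint 1 + \<sigma> leaves the exponent \<sigma>/2 - 1.\<close>
  obtain Cb where Cb: "Cb \<ge> 0" "\<And>n t. t > 0 \<Longrightarrow> norm (b n t) \<le> Cb * real (Suc n) powr - (1 + \<sigma>) * norm (of_real t powr (z / 2 - 1) * ?H t)"
  proof
    let ?\<rho> = "4 * (of_real pi)\<^sup>2 * (1 / x\<^sup>2)"
    let ?C = "exp ((norm (2 * of_real pi * w / x) + (1 + \<sigma>))\<^sup>2 / (4 * Re ?\<rho>))"
    show "?C \<ge> 0" by simp
    fix n t assume t: "(t::real) > 0"
    define m where "m = real (Suc n) * sqrt t"
    have m: "m > 0" using t by (simp add: m_def)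
    have \<rho>: "Re ?\<rho> > 0"
    proof -
      have "?\<rho> = of_real (4 * pi\<^sup>2) * (1 / x\<^sup>2)" by simp
      moreover have "Re (of_real r * y) = r * Re y" for r y by simp
      ultimately have eq: "Re ?\<rho> = 4 * pi\<^sup>2 * Re (1 / x\<^sup>2)" by (simp only:)
      have "4 * pi\<^sup>2 > 0" by simp
      from mult_pos_pos[OF this Re_inverse_sq_pos[OF x]] show ?thesis unfolding eq .
    qed
    have c: "norm (cosh (2 * of_real pi * w / x * of_real m)) \<le> exp (norm (2 * of_real pi * w / x) * m)"
      using norm_cosh_le[of "2 * of_real pi * w / x * of_real m"] m by (simp add: norm_mult norm_divide)
    have le: "norm (exp (- (?\<rho> * of_real (m\<^sup>2))) * cosh (2 * of_real pi * w / x * of_real m)) \<le> ?C * m powr - (1 + \<sigma>)"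
      by (rule norm_exp_mult_le_powr[OF \<rho> _ m c]) (use \<sigma> in auto)
    have mp: "m powr - (1 + \<sigma>) = real (Suc n) powr - (1 + \<sigma>) * t powr (- (1 + \<sigma>) / 2)"
      using t by (simp add: m_def powr_mult powr_half_sqrt[symmetric] powr_powr del: of_nat_Suc)
    have "norm (b n t) = norm (of_real t powr (z + 1 / 2 - 1) * ?H t) *
        norm (exp (- (?\<rho> * of_real (m\<^sup>2))) * cosh (2 * of_real pi * w / x * of_real m))"
      unfolding b_def dual_term_eq[OF x t] m_def by (rule norm_mult)
    also have "\<dots> \<le> norm (of_real t powr (z + 1 / 2 - 1) * ?H t) * (?C * m powr - (1 + \<sigma>))"
      by (intro mult_left_mono le) auto
    finally have le1: "norm (b n t) \<le> norm (of_real t powr (z + 1 / 2 - 1) * ?H t) * (?C * m powr - (1 + \<sigma>))" .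
    have "norm (of_real t powr (z + 1 / 2 - 1) * ?H t) * t powr (- (1 + \<sigma>) / 2) = norm (of_real t powr (z / 2 - 1) * ?H t)"
    proof -
      have "t powr (\<sigma> + 1 / 2 - 1) * t powr (- (1 + \<sigma>) / 2) = t powr (\<sigma> / 2 - 1)"
      proof -
        have "(\<sigma> + 1 / 2 - 1) + (- (1 + \<sigma>) / 2) = \<sigma> / 2 - 1" by (simp add: field_simps)
        then show ?thesis by (simp only: powr_add[symmetric])
      qed
      then show ?thesis
        using t by (simp add: norm_mult norm_powr_of_real \<sigma>_def mult_ac)
    qed
    moreover have "norm (of_real t powr (z + 1 / 2 - 1) * ?H t) * (?C * m powr - (1 + \<sigma>)) =
       ?C * real (Suc n) powr - (1 + \<sigma>) * (norm (of_real t powr (z + 1 / 2 - 1) * ?H t) * t powr (- (1 + \<sigma>) / 2))"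
      unfolding mp by (simp only: mult_ac)
    ultimately have "norm (of_real t powr (z + 1 / 2 - 1) * ?H t) * (?C * m powr - (1 + \<sigma>)) =
       ?C * real (Suc n) powr - (1 + \<sigma>) * norm (of_real t powr (z / 2 - 1) * ?H t)"
      by (simp only:)
    with le1 show "norm (b n t) \<le> ?C * real (Suc n) powr - (1 + \<sigma>) * norm (of_real t powr (z / 2 - 1) * ?H t)"
      by (simp only:)
  qed

  have g: "integrable halfline (\<lambda>t. norm (of_real t powr (y - 1) * ?H t))" if "Re y > 0" for y
    using mellin_exp_cos_of_real[OF that, of w] by (intro integrable_norm) (auto simp: has_bochner_integral_iff)
  have pser: "summable (\<lambda>n. C * real (Suc n) powr - s)" if "s > 1" for C s :: real
  proof -
    have "summable (\<lambda>n. real n powr - s)" using that by (simp add: summable_real_powr_iff)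
    then have "summable (\<lambda>n. real (Suc n) powr - s)" by (subst summable_Suc_iff)
    then show ?thesis by (rule summable_mult)
  qed

  have a_sums: "integrable halfline (\<lambda>t. \<Sum>n. a n t)" "(\<lambda>n. integral\<^sup>L halfline (a n)) sums integral\<^sup>L halfline (\<lambda>t. \<Sum>n. a n t)"
    using integrable_suminf_bounded[OF am g[of "z + 1"] pser[of 2 Ca]] integral_sums_bounded[OF am g[of "z + 1"] pser[of 2 Ca]]
      Ca assms(1) by (auto simp: space_restrict_space)
  have b_sums: "integrable halfline (\<lambda>t. \<Sum>n. b n t)" "(\<lambda>n. integral\<^sup>L halfline (b n)) sums integral\<^sup>L halfline (\<lambda>t. \<Sum>n. b n t)"
    using integrable_suminf_bounded[OF bm g[of "z / 2"] pser[of "1 + \<sigma>" Cb]] integral_sums_bounded[OF bm g[of "z / 2"] pser[of "1 + \<sigma>" Cb]]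
      Cb assms(1) \<sigma> by (auto simp: space_restrict_space)

  \<comment> \<open>The factor in front of the transformed series: A^(-1/2) = 2 sqrt t/x, whose sqrt
    t goes into the integrand, and B^2/(4 A) = w^2/4, which does not depend on t.\<close>
  define E where "E = 2 * of_real (sqrt pi) / x * exp (- (w\<^sup>2 / 4))"
  have theta: "2 * (\<Sum>n. a n t) = E * (of_real t powr (z + 1 / 2 - 1) * ?H t) + 2 * E * (\<Sum>n. b n t) - of_real t powr (z - 1) * ?H t"
    if "t \<in> space halfline" for t
  proof -
    have t: "t > 0" using that by (simp add: space_restrict_space)
    have ReA: "Re (A t) > 0" unfolding A_def using t by (intro Re_sq_div_pos[OF x]) auto
    note th = theta_transformation[OF ReA, of "B t"]
    have A2: "A t powr (- (1 / 2)) = 2 * of_real (sqrt t) / x"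
    proof -
      have "A t powr (- (1 / 2)) = exp (- (1 / 2) * (2 * Ln x - of_real (ln (4 * t))))"
        using Ln_sq_div[OF x, of "4 * t"] t x by (simp add: A_def powr_def)
      also have "- (1 / 2) * (2 * Ln x - of_real (ln (4 * t))) = of_real (ln (4 * t) / 2) - Ln x"
        by (simp add: field_simps)
      also have "exp (of_real (ln (4 * t) / 2) - Ln x) = exp (of_real (ln (4 * t) / 2)) / x"
        using x by (simp add: exp_diff)
      also have "exp (ln (4 * t) / 2) = sqrt (4 * t)"
        using t by (simp add: powr_half_sqrt[symmetric] powr_def)
      then have "exp (complex_of_real (ln (4 * t) / 2)) = of_real (2 * sqrt t)"
        unfolding exp_of_real by (simp add: real_sqrt_mult)
      finally show ?thesis by simp
    qed
    have BA: "- (B t)\<^sup>2 / (4 * A t) = - (w\<^sup>2 / 4)"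
      using t x by (simp add: A_def B_def power_divide power_mult_distrib flip: of_real_power)
    have tt: "of_real t powr (z - 1) * of_real (sqrt t) = of_real t powr (z + 1 / 2 - 1)"
    proof -
      have "complex_of_real (sqrt t) = of_real t powr (1 / 2)"
        using t powr_of_real[of t "1 / 2"] by (simp add: powr_half_sqrt)
      then show ?thesis by (simp add: algebra_simps flip: powr_add)
    qed
    let ?U = "\<lambda>n. exp (- (of_nat (Suc n))\<^sup>2 * A t) * cos (of_nat (Suc n) * B t)"
    let ?V = "\<lambda>n. exp (- (of_nat (Suc n) * of_real pi)\<^sup>2 / A t) * cosh (of_nat (Suc n) * of_real pi * B t / A t)"
    have sa: "(\<Sum>n. a n t) = of_real t powr (z - 1) * ?H t * suminf ?U"
      unfolding a_eq[OF t] by (rule suminf_mult[OF th(1)])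
    have sb: "(\<Sum>n. b n t) = of_real t powr (z - 1) * of_real (sqrt t) * ?H t * suminf ?V"
      unfolding b_eq tt by (rule suminf_mult[OF th(2)])
    have U: "2 * suminf ?U = of_real (sqrt pi) * (2 * of_real (sqrt t) / x) * exp (- (w\<^sup>2 / 4)) * (1 + 2 * suminf ?V) - 1"
      using th(3) unfolding A2 BA by (simp only: eq_diff_eq add.commute)
    have "2 * (\<Sum>n. a n t) = of_real t powr (z - 1) * ?H t * (2 * suminf ?U)"
      unfolding sa by simp
    also have "\<dots> = E * (of_real t powr (z - 1) * of_real (sqrt t) * ?H t) + 2 * E * (\<Sum>n. b n t) - of_real t powr (z - 1) * ?H t"
      unfolding U sb E_def by (simp add: algebra_simps)
    finally show ?thesis unfolding tt .
  qed

  \<comment> \<open>The constant terms 1 on the two sides of the theta identity lead to these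
    integrals: the left one becomes the term with Gamma(z), the right one the term with Gamma(z +
    1/2).\<close>
  have h1: "has_bochner_integral halfline (\<lambda>t. of_real t powr (z - 1) * ?H t) (hyp_gamma w z)"
    and h2: "has_bochner_integral halfline (\<lambda>t. of_real t powr (z + 1 / 2 - 1) * ?H t) (hyp_gamma w (z + 1 / 2))"
    by (rule mellin_exp_cos_of_real; use assms(1) in simp)+
  have "2 * integral\<^sup>L halfline (\<lambda>t. \<Sum>n. a n t) = integral\<^sup>L halfline (\<lambda>t. 2 * (\<Sum>n. a n t))"
    by simp
  also have "\<dots> = integral\<^sup>L halfline (\<lambda>t. E * (of_real t powr (z + 1 / 2 - 1) * ?H t) + 2 * E * (\<Sum>n. b n t) - of_real t powr (z - 1) * ?H t)"
    by (rule Bochner_Integration.integral_cong[OF refl theta])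
  also have "has_bochner_integral halfline (\<lambda>t. E * (of_real t powr (z + 1 / 2 - 1) * ?H t) + 2 * E * (\<Sum>n. b n t) - of_real t powr (z - 1) * ?H t)
     (E * hyp_gamma w (z + 1 / 2) + 2 * E * integral\<^sup>L halfline (\<lambda>t. \<Sum>n. b n t) - hyp_gamma w z)"
    by (intro has_bochner_integral_diff has_bochner_integral_add has_bochner_integral_mult_right h1 h2
        has_bochner_integral_integrable b_sums(1))
  then have "integral\<^sup>L halfline (\<lambda>t. E * (of_real t powr (z + 1 / 2 - 1) * ?H t) + 2 * E * (\<Sum>n. b n t) - of_real t powr (z - 1) * ?H t) =
     E * hyp_gamma w (z + 1 / 2) + 2 * E * integral\<^sup>L halfline (\<lambda>t. \<Sum>n. b n t) - hyp_gamma w z"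
    by (rule has_bochner_integral_integral_eq)
  finally have main: "2 * integral\<^sup>L halfline (\<lambda>t. \<Sum>n. a n t) =
     E * hyp_gamma w (z + 1 / 2) + 2 * E * integral\<^sup>L halfline (\<lambda>t. \<Sum>n. b n t) - hyp_gamma w z" .

  have S_sums: "(\<lambda>n. S (Suc n)) sums (1 / 2 * integral\<^sup>L halfline (\<lambda>t. \<Sum>n. a n t))"
    unfolding Sa by (rule sums_mult[OF a_sums(2)])
  define G where "G = 1 / 2 * Gamma (1 / 2 + z) * x powr (2 * z + 1)"
  \<comment> \<open>Termwise integration controls only \<open>G * T (Suc n)\<close>, so the constant
    has to be divided out; neither Gamma(z + 1/2) nor a power of x vanishes.\<close>
  have G0: "G \<noteq> 0"
  proof -
    have "1 / 2 + z \<notin> \<int>\<^sub>\<le>\<^sub>0" using assms(1) by (auto elim!: nonpos_Ints_cases simp: complex_eq_iff)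
    then show ?thesis using x by (simp add: G_def Gamma_eq_zero_iff)
  qed
  have "integral\<^sup>L halfline (b n) = G * T (Suc n)" for n
    using bT[of n] by (simp only: has_bochner_integral_iff G_def)
  then have GT: "(\<lambda>n. G * T (Suc n)) sums integral\<^sup>L halfline (\<lambda>t. \<Sum>n. b n t)"
    using b_sums(2) by (simp only:)
  then have T_sums: "(\<lambda>n. T (Suc n)) sums (integral\<^sup>L halfline (\<lambda>t. \<Sum>n. b n t) / G)"
    using sums_divide[OF GT, of G] G0 by simp
  have bsum: "integral\<^sup>L halfline (\<lambda>t. \<Sum>n. b n t) = G * (\<Sum>n. T (Suc n))"
    using sums_unique[OF T_sums] G0 by (simp add: field_simps)
  have xp: "x powr (2 * z + 1) = x powr (2 * z) * x" using x by (simp add: powr_add)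
  have "2 * (\<Sum>n. S (Suc n)) = 1 / 2 * (2 * integral\<^sup>L halfline (\<lambda>t. \<Sum>n. a n t))"
    using sums_unique[OF S_sums] by simp
  also have "\<dots> = 1 / 2 * (E * hyp_gamma w (z + 1 / 2) + 2 * E * (G * (\<Sum>n. T (Suc n))) - hyp_gamma w z)"
    unfolding main bsum ..
  finally have fin: "2 * (\<Sum>n. S (Suc n)) = 1 / 2 * (E * hyp_gamma w (z + 1 / 2) + 2 * E * (G * (\<Sum>n. T (Suc n))) - hyp_gamma w z)" .
  have EG: "E * G = of_real (sqrt pi) * x powr (2 * z) * Gamma (1 / 2 + z) * exp (- (w\<^sup>2 / 4))"
    unfolding E_def G_def xp using x by simp
  have Eh: "1 / 2 * (E * hyp_gamma w (z + 1 / 2)) = of_real (sqrt pi) / x * Gamma (1 / 2 + z) * exp (- (w\<^sup>2 / 4))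
          * hyp1F1 (1 / 2 + z) (1 / 2) (- (w\<^sup>2 / 4))"
    unfolding E_def hyp_gamma_def add.commute[of z] by simp
  show ?thesis
    unfolding EG[symmetric] Eh[symmetric] fin
    using sums_summable[OF S_sums] sums_summable[OF T_sums]
    by (simp add: hyp_gamma_def algebra_simps)
qed

end
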